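(* Let $n\in\mathbf{N}$, $p>1$, $\mu>0$ and $\beta=1$. Let $f\in H^1(\mathbf{R}^n)$ and $g\in L^2(\mathbf{R}^n)$ be non-negative functions, with $g$ not vanishing identically. For $\varepsilon>0$, suppose that $u$ is an energy solution on $[0,T)$ of \[ u_{tt}-\Delta u+\frac{\mu}{1+t}u_t=|u_t|^p \ \text{ in } \mathbf{R}^n\times[0,\infty),\qquad u(x,0)=\varepsilon f(x),\ u_t(x,0)=\varepsilon g(x), \] and that $\operatorname{supp} u\subset\{(x,t)\in\mathbf{R}^n\times[0,\infty): |x|\le t+R\}$ for some $R\ge 1$. Then there exists a constant $\varepsilon_0=\varepsilon_0(f,g,n,p,\mu,R)>0$ and a constant $C>0$ independent of $\varepsilon$ such that for all $0<\varepsilon\le\varepsilon_0$: \begin{itemize} \item if $1<p<p_c(n+2\mu)$, then $T\le C\varepsilon^{-(p-1)/\{1-(n+2\mu-1)(p-1)/2\}}$; \item if $p=p_c(n+2\mu)$, then $T\le \exp\left(C\varepsilon^{-(p-1)}\right)$. \end{itemize}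
   Context: For real $N>1$, $p_c(N):=\frac{N+1}{N-1}$; here $N=n+2\mu>1$. Energy solution: for $\mu\ge 0$, $\beta\ge1$, $p>1$, a function $u$ is an energy solution of the Cauchy problem $u_{tt}-\Delta u+\frac{\mu}{(1+t)^\beta}u_t=|u_t|^p$, $u(\cdot,0)=\varepsilon f$, $u_t(\cdot,0)=\varepsilon g$ on $[0,T)$ if $u\in C([0,T),H^1(\mathbf{R}^n))\cap C^1([0,T),L^2(\mathbf{R}^n))\cap C^1((0,T),L^p(\mathbf{R}^n))$, $u(\cdot,0)=\varepsilon f$, $u_t(\cdot,0)=\varepsilon g$, and for every $\phi\in C_0^\infty(\mathbf{R}^n\times[0,T))$ and every $t\in[0,T)$, \[ \int_{\mathbf{R}^n}u_t(x,t)\phi(x,t)dx-\int_{\mathbf{R}^n}u_t(x,0)\phi(x,0)dx+\int_0^t\!\!\int_{\mathbf{R}^n}\{-u_t\phi_t+\nabla u\cdot\nabla\phi\}dxds+\int_0^t\!\!\int_{\mathbf{R}^n}\frac{\mu u_t(x,s)}{(1+s)^\beta}\phi(x,s)dxds=\int_0^t\!\!\int_{\mathbf{R}^n}|u_t(x,s)|^p\phi(x,s)dxds. \] In this theorem $\beta=1$. *)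

theory Defs
  imports "HOL-Analysis.Analysis"
begin

definition p_c :: "real \<Rightarrow> real" where
  "p_c N = (N + 1) / (N - 1)"

coinductive smooth :: "('a::euclidean_space \<Rightarrow> real) \<Rightarrow> bool" where
  "(\<forall>x. f differentiable (at x)) \<Longrightarrow>
   (\<forall>i\<in>Basis. smooth (\<lambda>x. frechet_derivative f (at x) i)) \<Longrightarrow> smooth f"

definition test_fun :: "('a::euclidean_space \<Rightarrow> real) \<Rightarrow> bool" where
  "test_fun \<psi> \<longleftrightarrow> smooth \<psi> \<and> compact (closure {x. \<psi> x \<noteq> 0})"

text \<open>Test functions C_0^infinity(R^n x [0,T)): smooth functions on R^n x R whose
  (compact) support lies in R^n x (-infinity, T).\<close>
definition st_test :: "real \<Rightarrow> ('a::euclidean_space \<Rightarrow> real \<Rightarrow> real) \<Rightarrow> bool" where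
  "st_test T \<phi> \<longleftrightarrow> smooth (\<lambda>z::'a \<times> real. \<phi> (fst z) (snd z)) \<and>
     compact (closure {z::'a \<times> real. \<phi> (fst z) (snd z) \<noteq> 0}) \<and>
     closure {z::'a \<times> real. \<phi> (fst z) (snd z) \<noteq> 0} \<subseteq> UNIV \<times> {..<T}"

definition memLp :: "real \<Rightarrow> ('a::euclidean_space \<Rightarrow> 'b::real_normed_vector) \<Rightarrow> bool" where
  "memLp q h \<longleftrightarrow> h \<in> borel_measurable lebesgue \<and>
     integrable lebesgue (\<lambda>x. norm (h x) powr q)"

definition weak_grad :: "('a::euclidean_space \<Rightarrow> real) \<Rightarrow> ('a \<Rightarrow> 'a) \<Rightarrow> bool" where
  "weak_grad h G \<longleftrightarrow> (\<forall>\<psi>. test_fun \<psi> \<longrightarrow> (\<forall>i\<in>Basis.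
     (\<integral>x. h x * frechet_derivative \<psi> (at x) i \<partial>lebesgue) =
       - (\<integral>x. (G x \<bullet> i) * \<psi> x \<partial>lebesgue)))"

definition inH1 :: "('a::euclidean_space \<Rightarrow> real) \<Rightarrow> bool" where
  "inH1 h \<longleftrightarrow> memLp 2 h \<and> (\<exists>G. memLp 2 G \<and> weak_grad h G)"

definition Lp_cont_on :: "real \<Rightarrow> real set \<Rightarrow> (real \<Rightarrow> 'a::euclidean_space \<Rightarrow> 'b::real_normed_vector) \<Rightarrow> bool" where
  "Lp_cont_on q S h \<longleftrightarrow> (\<forall>t\<in>S. memLp q (h t)) \<and>
     (\<forall>t\<in>S. ((\<lambda>s. \<integral>x. norm (h s x - h t x) powr q \<partial>lebesgue) \<longlongrightarrow> 0) (at t within S))"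

definition Lp_deriv_on :: "real \<Rightarrow> real set \<Rightarrow> (real \<Rightarrow> 'a::euclidean_space \<Rightarrow> real) \<Rightarrow> (real \<Rightarrow> 'a \<Rightarrow> real) \<Rightarrow> bool" where
  "Lp_deriv_on q S h h' \<longleftrightarrow>
     (\<forall>t\<in>S. ((\<lambda>s. \<integral>x. \<bar>(h s x - h t x) / (s - t) - h' t x\<bar> powr q \<partial>lebesgue) \<longlongrightarrow> 0) (at t within S))"

definition sgrad :: "('a::euclidean_space \<Rightarrow> real \<Rightarrow> real) \<Rightarrow> 'a \<Rightarrow> real \<Rightarrow> 'a" where
  "sgrad \<phi> x s = (\<Sum>i\<in>Basis. frechet_derivative (\<lambda>y. \<phi> y s) (at x) i *\<^sub>R i)"

text \<open>Energy solution on [0,T). v plays the role of u_t, Du that of the (weak) spatial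
  gradient of u; both are determined a.e. by u.\<close>
definition energy_solution :: "real \<Rightarrow> real \<Rightarrow> real \<Rightarrow> real \<Rightarrow> ('a::euclidean_space \<Rightarrow> real)
    \<Rightarrow> ('a \<Rightarrow> real) \<Rightarrow> real \<Rightarrow> ('a \<Rightarrow> real \<Rightarrow> real) \<Rightarrow> bool" where
  "energy_solution \<mu> \<beta> p \<epsilon> f g T u \<longleftrightarrow>
   (\<exists>(v :: 'a \<Rightarrow> real \<Rightarrow> real) (Du :: 'a \<Rightarrow> real \<Rightarrow> 'a).
     \<comment> \<open>u in C([0,T), H^1)\<close>
     (\<forall>t\<in>{0..<T}. weak_grad (\<lambda>x. u x t) (\<lambda>x. Du x t)) \<and>
     Lp_cont_on 2 {0..<T} (\<lambda>t x. u x t) \<and> Lp_cont_on 2 {0..<T} (\<lambda>t x. Du x t) \<and>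
     \<comment> \<open>u in C^1([0,T), L^2) with derivative v\<close>
     Lp_cont_on 2 {0..<T} (\<lambda>t x. v x t) \<and> Lp_deriv_on 2 {0..<T} (\<lambda>t x. u x t) (\<lambda>t x. v x t) \<and>
     \<comment> \<open>u in C^1((0,T), L^p) with derivative v\<close>
     Lp_cont_on p {0<..<T} (\<lambda>t x. u x t) \<and> Lp_cont_on p {0<..<T} (\<lambda>t x. v x t) \<and>
     Lp_deriv_on p {0<..<T} (\<lambda>t x. u x t) (\<lambda>t x. v x t) \<and>
     \<comment> \<open>initial data\<close>
     (AE x in lebesgue. u x 0 = \<epsilon> * f x) \<and> (AE x in lebesgue. v x 0 = \<epsilon> * g x) \<and>
     \<comment> \<open>weak formulation\<close>
     (\<forall>\<phi>. st_test T \<phi> \<longrightarrow> (\<forall>t\<in>{0..<T}.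
        (\<integral>x. v x t * \<phi> x t \<partial>lebesgue) - (\<integral>x. v x 0 * \<phi> x 0 \<partial>lebesgue)
        + (LINT s:{0..t}|lborel. (\<integral>x. - v x s * deriv (\<lambda>r. \<phi> x r) s + Du x s \<bullet> sgrad \<phi> x s \<partial>lebesgue))
        + (LINT s:{0..t}|lborel. (\<integral>x. \<mu> * v x s / (1 + s) powr \<beta> * \<phi> x s \<partial>lebesgue))
        = (LINT s:{0..t}|lborel. (\<integral>x. \<bar>v x s\<bar> powr p * \<phi> x s \<partial>lebesgue)))))"

end

theory Submission
  imports Defs "HOL-Computational_Algebra.Polynomial" "HOL-Real_Asymp.Real_Asymp"
    "HOL-Probability.Distributions"
begin

text \<open>
  Test the equation with \<open>exp (x \<bullet> w)\<close> for one fixed unit vector \<open>w\<close>, cut off in space outside the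
  support of the solution and in time around an arbitrary interior instant. With \<open>F\<close>, \<open>U\<close>, \<open>N\<close> the
  integrals of \<open>u\<^sub>t\<close>, \<open>u\<close>, \<open>|u\<^sub>t|\<^sup>p\<close> against this weight this gives \<open>U' = F\<close> and
  \<open>F' = N + U - \<mu> F / (1 + t)\<close>. For \<open>G = (1 + t)\<^sup>\<mu> e\<^sup>-\<^sup>t F\<close> one deduces
  \<open>G \<ge> G(0) / 2 + (1 / 2) \<integral> (1 + s)\<^sup>\<mu> e\<^sup>-\<^sup>s N ds\<close>. The weight has mass \<open>O((1 + t)\<^bsup>(n-1)/2\<^esup> e\<^sup>t)\<close> on the
  ball of radius \<open>t + R + 1\<close>, the same order as for its average over all directions, so Jensen's
  inequality bounds the integrand below by a multiple of \<open>(1 + t)\<^bsup>-a\<^esup> G\<^sup>p\<close> with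
  \<open>a = (n + 2 \<mu> - 1) (p - 1) / 2\<close>, and the resulting Bernoulli inequality blows up in the stated time
  when \<open>a \<le> 1\<close>.
\<close>

section \<open>Smooth functions and cutoffs\<close>

text \<open>The factor \<open>(1 + t)^\<mu>\<close> integrates the damping, and
  \<open>exp (- t)\<close> turns the weight into \<open>exp (x \<bullet> w - t)\<close>, a solution
  of the free wave equation. Write \<open>m\<close> for their product, \<open>G = m F\<close>,
  \<open>K = m U\<close>. Then \<open>G' = m N + K - G\<close> and
  \<open>K' = G - K + \<mu> / (1 + t) K\<close>. The exchange terms cancel in the sum, so once
  \<open>K \<ge> 0\<close> is known, \<open>G + K\<close> dominates \<open>G(0)\<close> plus the
  integral of \<open>m N\<close>; inserting this into the first equation leaves a rate 2 in front of
  \<open>G\<close>, whence the factor 1/2. The exponent \<open>a\<close> is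
  \<open>(n - 1) / 2 + \<mu>\<close>, the growth rate of \<open>m\<close> times the mass of the
  weight, multiplied by \<open>p - 1\<close> from Jensen; \<open>a = 1\<close> is exactly
  \<open>p = p_c (n + 2 \<mu>)\<close>. Two obstacles shape the details. Continuity in L^p is given
  on the open interval only, so \<open>N\<close> is uncontrolled at time 0. And the support is
  prescribed for u alone: that of its time derivative, and even that of g, must be recovered from
  L^2 difference quotients, which enlarges R to R + 1. Finally, the spatial cutoff depends on T,
  while the constants must not.\<close>

text \<open>Products and compositions are not guarded for coinduction on \<open>smooth\<close>; counting derivatives
  turns the closure properties into inductions.\<close>

primrec Ck :: "nat \<Rightarrow> ('a::euclidean_space \<Rightarrow> real) \<Rightarrow> bool" where
  "Ck 0 f \<longleftrightarrow> True"
| "Ck (Suc k) f \<longleftrightarrow> (\<forall>x. f differentiable (at x)) \<and>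
     (\<forall>i\<in>Basis. Ck k (\<lambda>x. frechet_derivative f (at x) i))"

lemma smooth_iff_Ck: "smooth f \<longleftrightarrow> (\<forall>k. Ck k f)"
proof
  have "smooth f \<Longrightarrow> Ck k f" for k and f :: "'a \<Rightarrow> real"
    by (induction k arbitrary: f) (auto elim: smooth.cases)
  then show "smooth f \<Longrightarrow> \<forall>k. Ck k f" by blast
  show "\<forall>k. Ck k f \<Longrightarrow> smooth f"
  proof (coinduction arbitrary: f rule: smooth.coinduct)
    case (smooth f)
    then have "Ck (Suc k) f" for k by blast
    then show ?case by auto
  qed
qed

lemma Ck_SucI:
  assumes "\<And>x. (f has_derivative f' x) (at x)" and "\<And>i. i \<in> Basis \<Longrightarrow> Ck k (\<lambda>x. f' x i)"
  shows "Ck (Suc k) f"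
proof -
  have "frechet_derivative f (at x) = f' x" for x
    using assms(1) by (metis frechet_derivative_at)
  then show ?thesis
    using assms by (auto simp: differentiable_def)
qed

lemma Ck_SucD: "Ck (Suc k) f \<Longrightarrow> Ck k f"
  by (induction k arbitrary: f) auto

lemma Ck_has_derivative:
  "Ck (Suc k) f \<Longrightarrow> (f has_derivative frechet_derivative f (at x)) (at x)"
  by (simp add: frechet_derivative_works[symmetric])

lemma Ck_const: "Ck k (\<lambda>x. c)"
  by (induction k arbitrary: c) (auto intro!: Ck_SucI[where f' = "\<lambda>x h. 0"])

lemma Ck_linear: "bounded_linear l \<Longrightarrow> Ck k l"
  by (cases k) (auto intro!: Ck_SucI[where f' = "\<lambda>x. l"] Ck_const bounded_linear_imp_has_derivative
      simp del: Ck.simps(2))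

lemma Ck_add: "Ck k f \<Longrightarrow> Ck k g \<Longrightarrow> Ck k (\<lambda>x. f x + g x)"
proof (induction k arbitrary: f g)
  case (Suc k)
  show ?case
    by (rule Ck_SucI[OF has_derivative_add[OF Suc.prems[THEN Ck_has_derivative]]])
      (use Suc in auto)
qed simp

lemma Ck_mult: "Ck k f \<Longrightarrow> Ck k g \<Longrightarrow> Ck k (\<lambda>x. f x * g x)"
proof (induction k arbitrary: f g)
  case (Suc k)
  show ?case
    by (rule Ck_SucI[OF has_derivative_mult[OF Suc.prems[THEN Ck_has_derivative]]])
      (use Suc Ck_SucD[OF Suc.prems(1)] Ck_SucD[OF Suc.prems(2)] in \<open>auto intro!: Ck_add\<close>)
qed simp

lemma Ck_sum: "finite A \<Longrightarrow> (\<And>a. a \<in> A \<Longrightarrow> Ck k (f a)) \<Longrightarrow> Ck k (\<lambda>x. \<Sum>a\<in>A. f a x)"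
  by (induction A rule: finite_induct) (auto intro!: Ck_const Ck_add)

lemma Ck_compose_real:
  fixes h :: "real \<Rightarrow> real"
  shows "Ck k h \<Longrightarrow> Ck k g \<Longrightarrow> Ck k (\<lambda>x. h (g x))"
proof (induction k arbitrary: h g)
  case (Suc k)
  \<comment> \<open>The derivative of \<open>h\<close> as a real function, so that the chain rule
    yields \<open>h' (g x)\<close> times a partial derivative of \<open>g\<close>, to which the
    induction hypothesis and \<open>Ck_mult\<close> apply.\<close>
  define h' where "h' y = frechet_derivative h (at y) 1" for y
  have h: "(h has_derivative (\<lambda>d. h' y * d)) (at y)" for y
  proof -
    have d: "(h has_derivative frechet_derivative h (at y)) (at y)"
      by (rule Ck_has_derivative[OF Suc.prems(1)])
    have "frechet_derivative h (at y) = (\<lambda>d. h' y * d)"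
    proof
      show "frechet_derivative h (at y) k = h' y * k" for k
        using linear_cmul[OF has_derivative_linear[OF d], of k 1] by (simp add: h'_def)
    qed
    with d show ?thesis by simp
  qed
  have 1: "((\<lambda>x. h (g x)) has_derivative (\<lambda>d. h' (g x) * frechet_derivative g (at x) d)) (at x)" for x
    by (rule has_derivative_compose[OF Ck_has_derivative[OF Suc.prems(2)] h])
  have "Ck k h'"
    using Suc.prems(1) by (simp add: h'_def[abs_def])
  with 1 show ?case
    by (intro Ck_SucI[OF 1]) (use Suc.IH[of h' g] Ck_SucD[OF Suc.prems(2)] Suc.prems(2) in \<open>auto intro!: Ck_mult\<close>)
qed simp

lemma Ck_compose_linear:
  fixes f :: "'a::euclidean_space \<Rightarrow> real" and l :: "'b::euclidean_space \<Rightarrow> 'a"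
  assumes l: "bounded_linear l"
  shows "Ck k f \<Longrightarrow> Ck k (\<lambda>x. f (l x))"
proof (induction k arbitrary: f)
  case (Suc k)
  define f' where "f' x = frechet_derivative f (at x)" for x
  have f: "(f has_derivative f' y) (at y)" for y
    using Ck_has_derivative[OF Suc.prems] by (simp add: f'_def)
  have 1: "((\<lambda>x. f (l x)) has_derivative (\<lambda>d. f' (l x) (l d))) (at x)" for x
    by (rule has_derivative_compose[OF bounded_linear_imp_has_derivative[OF l] f])
  \<comment> \<open>\<open>Ck\<close> controls derivatives along basis vectors only, so the
    derivative in the direction \<open>l d\<close> is expanded into these.\<close>
  have "f' (l x) (l d) = (\<Sum>j\<in>Basis. (l d \<bullet> j) * f' (l x) j)" for x d
  proof -
    interpret linear "f' (l x)"
      using f has_derivative_linear by blast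
    have "f' (l x) (l d) = f' (l x) (\<Sum>j\<in>Basis. (l d \<bullet> j) *\<^sub>R j)"
      by (simp add: euclidean_representation)
    then show ?thesis by (simp add: sum scaleR)
  qed
  moreover have "Ck k (\<lambda>x. \<Sum>j\<in>Basis. (l i \<bullet> j) * f' (l x) j)" for i
    using Suc.prems by (intro Ck_sum Ck_mult Ck_const Suc.IH[of "\<lambda>x. f' x _"]) (auto simp: f'_def)
  ultimately have "Ck k (\<lambda>x. f' (l x) (l i))" for i
    by simp
  with 1 show ?case by (rule Ck_SucI)
qed simp

lemma Ck_has_real_derivative:
  assumes "\<And>x. (h has_real_derivative h' x) (at x)" and "Ck k h'"
  shows "Ck (Suc k) h"
  by (rule Ck_SucI[where f' = "\<lambda>x d. h' x * d"])
    (use assms in \<open>auto simp: has_field_derivative_def\<close>)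

lemma smooth_const: "smooth (\<lambda>x. c)"
  and smooth_linear: "bounded_linear l \<Longrightarrow> smooth l"
  and smooth_add: "smooth f \<Longrightarrow> smooth g \<Longrightarrow> smooth (\<lambda>x. f x + g x)"
  and smooth_mult: "smooth f \<Longrightarrow> smooth g \<Longrightarrow> smooth (\<lambda>x. f x * g x)"
  and smooth_sum: "finite A \<Longrightarrow> (\<And>a. a \<in> A \<Longrightarrow> smooth (F a)) \<Longrightarrow> smooth (\<lambda>x. \<Sum>a\<in>A. F a x)"
  by (simp_all add: smooth_iff_Ck Ck_const Ck_linear Ck_add Ck_mult Ck_sum)

lemma smooth_compose_real: "smooth h \<Longrightarrow> smooth g \<Longrightarrow> smooth (\<lambda>x. h (g x))"
  by (simp add: smooth_iff_Ck Ck_compose_real)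

lemma smooth_compose_linear: "smooth f \<Longrightarrow> bounded_linear l \<Longrightarrow> smooth (\<lambda>x. f (l x))"
  by (simp add: smooth_iff_Ck Ck_compose_linear)

lemma smooth_has_real_derivative:
  assumes "\<And>x. (h has_real_derivative h' x) (at x)" and "smooth h'"
  shows "smooth h"
  unfolding smooth_iff_Ck
proof
  fix k
  show "Ck k h"
    using Ck_has_real_derivative[OF assms(1)] assms(2)
    by (cases k) (auto simp: smooth_iff_Ck simp del: Ck.simps(2))
qed

lemma smooth_frechet:
  assumes "smooth f" shows "(f has_derivative frechet_derivative f (at x)) (at x)"
    and "i \<in> Basis \<Longrightarrow> smooth (\<lambda>x. frechet_derivative f (at x) i)"
  using assms by (auto elim!: smooth.cases simp: frechet_derivative_works[symmetric])

lemma smooth_exp: "smooth (exp :: real \<Rightarrow> real)"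
proof -
  have "Ck k (exp :: real \<Rightarrow> real)" for k
  proof (induction k)
    case (Suc k)
    then show ?case by (intro Ck_has_real_derivative[of exp exp]) (auto intro!: derivative_eq_intros)
  qed simp
  then show ?thesis by (simp add: smooth_iff_Ck)
qed

lemma smooth_inner_self: "smooth (\<lambda>x::'a::euclidean_space. x \<bullet> x)"
proof -
  have "smooth (\<lambda>x::'a. \<Sum>i\<in>Basis. (x \<bullet> i) * (x \<bullet> i))"
    by (intro smooth_sum smooth_mult smooth_linear bounded_linear_inner_left) auto
  then show ?thesis by (simp add: euclidean_inner[symmetric])
qed

section \<open>Flat functions and smooth cutoffs\<close>

definition flat_fun :: "real poly \<Rightarrow> real \<Rightarrow> real" where
  "flat_fun P x = (if x > 0 then poly P (1 / x) * exp (- (1 / x)) else 0)"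

lemma poly_exp_tendsto_0: "((\<lambda>y. poly P y * exp (- y)) \<longlongrightarrow> (0::real)) at_top"
proof -
  have "((\<lambda>y::real. y ^ k * exp (- y)) \<longlongrightarrow> 0) at_top" for k by real_asymp
  then have "((\<lambda>y::real. \<Sum>i\<le>degree P. coeff P i * (y ^ i * exp (- y))) \<longlongrightarrow> 0) at_top"
    by (intro tendsto_null_sum tendsto_mult_right_zero)
  then show ?thesis
    by (simp add: poly_altdef sum_distrib_right mult.assoc)
qed

text \<open>The polynomial factor closes the family under differentiation: with \<open>X\<close>
  standing for \<open>1 / x\<close>, the product rule replaces \<open>P\<close> by
  \<open>X^2 (P - P')\<close>. A single derivative formula therefore yields smoothness to all
  orders.\<close>

lemma flat_fun_deriv:
  "(flat_fun P has_real_derivative flat_fun ([:0, 0, 1:] * (P - pderiv P)) x) (at x)"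
proof -
  consider "x > 0" | "x < 0" | "x = 0" by linarith
  then show ?thesis
  proof cases
    case 1
    have "((\<lambda>x. poly P (1 / x) * exp (- (1 / x))) has_real_derivative
        flat_fun ([:0, 0, 1:] * (P - pderiv P)) x) (at x)"
    proof -
      have inv: "((\<lambda>x. 1 / x) has_real_derivative - (1 / x)\<^sup>2) (at x)"
        using 1 by (auto intro!: derivative_eq_intros simp: power2_eq_square)
      have "((\<lambda>x. poly P (1 / x) * exp (- (1 / x))) has_real_derivative
          poly (pderiv P) (1 / x) * - (1 / x)\<^sup>2 * exp (- (1 / x))
          + exp (- (1 / x)) * - (- (1 / x)\<^sup>2) * poly P (1 / x)) (at x)"
        by (intro DERIV_mult DERIV_chain2[OF poly_DERIV inv] DERIV_chain2[OF DERIV_exp] DERIV_minus inv)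
      moreover have "poly (pderiv P) (1 / x) * - (1 / x)\<^sup>2 * exp (- (1 / x))
          + exp (- (1 / x)) * - (- (1 / x)\<^sup>2) * poly P (1 / x)
          = flat_fun ([:0, 0, 1:] * (P - pderiv P)) x"
        using 1 by (simp add: flat_fun_def power2_eq_square algebra_simps)
      ultimately show ?thesis by simp
    qed
    moreover have "\<forall>\<^sub>F y in nhds x. poly P (1 / y) * exp (- (1 / y)) = flat_fun P y"
      using eventually_nhds_in_open[of "{0<..}" x] 1
      by (auto elim!: eventually_mono simp: flat_fun_def)
    ultimately show ?thesis
      by (subst DERIV_cong_ev[OF refl _ refl, of _ "\<lambda>x. poly P (1 / x) * exp (- (1 / x))"])
        (auto elim: eventually_mono)
  next
    case 2
    have "\<forall>\<^sub>F y in nhds x. flat_fun P y = 0"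
      using eventually_nhds_in_open[of "{..<0}" x] 2
      by (auto elim!: eventually_mono simp: flat_fun_def)
    then show ?thesis using 2
      by (subst DERIV_cong_ev[OF refl _ refl, of _ "\<lambda>x. 0"]) (auto simp: flat_fun_def)
  next
    case 3
    \<comment> \<open>From the right, the difference quotient at 0 is the same expression with
      \<open>P\<close> multiplied by \<open>1 / h\<close>, that is with \<open>pCons 0 P\<close>,
      and exponential decay beats every polynomial.\<close>
    have "((\<lambda>h. flat_fun P h / h) \<longlongrightarrow> 0) (at_right 0)"
    proof -
      have "((\<lambda>h. poly (pCons 0 P) (1 / h) * exp (- (1 / h))) \<longlongrightarrow> 0) (at_right (0::real))"
        by (rule filterlim_compose[OF poly_exp_tendsto_0]) real_asymp
      then show ?thesis
        by (rule Lim_transform_eventually)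
          (auto simp: flat_fun_def eventually_at_filter)
    qed
    moreover have "((\<lambda>h. flat_fun P h / h) \<longlongrightarrow> 0) (at_left 0)"
      by (rule Lim_transform_eventually[OF tendsto_const])
        (auto simp: flat_fun_def eventually_at_filter)
    ultimately have "((\<lambda>h. flat_fun P h / h) \<longlongrightarrow> 0) (at 0)"
      by (simp add: filterlim_split_at)
    then show ?thesis using 3 by (simp add: DERIV_def flat_fun_def)
  qed
qed

lemma smooth_flat_fun: "smooth (flat_fun P)"
proof -
  have "Ck k (flat_fun P)" for k
    by (induction k arbitrary: P) (auto intro!: Ck_has_real_derivative[OF flat_fun_deriv] simp del: Ck.simps(2))
  then show ?thesis by (simp add: smooth_iff_Ck)
qed

lemma smooth_imp_continuous: "smooth f \<Longrightarrow> continuous_on S f"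
  by (intro continuous_at_imp_continuous_on ballI has_derivative_continuous[OF smooth_frechet(1)])

text \<open>A nonnegative bump living on the unit interval is integrated, and the primitive is
  divided by its final value.\<close>

lemma smooth_step:
  obtains H :: "real \<Rightarrow> real"
  where "smooth H" and "\<And>x. H x \<ge> 0" and "\<And>x. x \<le> 0 \<Longrightarrow> H x = 0" and "\<And>x. x \<ge> 1 \<Longrightarrow> H x = 1"
proof -
  define b where "b x = flat_fun 1 x * flat_fun 1 (1 - x)" for x
  have b: "smooth b"
    unfolding b_def[abs_def]
    by (intro smooth_mult smooth_flat_fun smooth_compose_real[of "flat_fun 1" "\<lambda>x. 1 - x"])
       (use smooth_add[OF smooth_const[of 1] smooth_linear[OF bounded_linear_minus[OF bounded_linear_ident]]] in simp)
  have cont: "continuous_on S b" for S by (rule smooth_imp_continuous[OF b])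
  have nn: "b x \<ge> 0" for x by (simp add: b_def flat_fun_def)
  have z: "b x = 0" if "x \<le> 0 \<or> x \<ge> 1" for x using that by (auto simp: b_def flat_fun_def)
  \<comment> \<open>Starting the integral at -1 makes every \<open>x \<ge> 0\<close> an interior
    point, so the fundamental theorem gives a two-sided derivative at 0 as well.\<close>
  define B where "B x = (if x \<ge> -1 then integral {-1..x} b else 0)" for x
  have int: "b integrable_on {x..y}" for x y using cont integrable_continuous_interval by blast
  have B0: "B x = 0" if "x \<le> 0" for x
  proof -
    have "integral {-1..x} b = integral {-1..x} (\<lambda>x. 0)"
      by (rule integral_cong) (use that z in auto)
    then show ?thesis by (simp add: B_def)
  qed
  have B1: "B x = B 1" if "x \<ge> 1" for x
  proof -
    have "integral {1..x} b = integral {1..x} (\<lambda>x. 0)"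
      by (rule integral_cong) (use that z in auto)
    then show ?thesis
      using Henstock_Kurzweil_Integration.integral_combine[of "-1" 1 x b] that int by (simp add: B_def)
  qed
  have deriv: "(B has_real_derivative b x) (at x)" for x
  proof (cases "x \<ge> 0")
    case True
    have "((\<lambda>u. integral {-1..u} b) has_real_derivative b x) (at x within {-1..x+1})"
      by (rule integral_has_real_derivative) (use cont True in auto)
    then have "((\<lambda>u. integral {-1..u} b) has_real_derivative b x) (at x)"
      using True by (simp add: at_within_Icc_at)
    moreover have "\<forall>\<^sub>F y in nhds x. B y = integral {-1..y} b"
      using eventually_nhds_in_open[of "{-1<..}" x] True
      by (auto elim!: eventually_mono simp: B_def)
    ultimately show ?thesis
      by (subst DERIV_cong_ev[OF refl _ refl, of _ "\<lambda>y. integral {-1..y} b"]) auto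
  next
    case False
    have "\<forall>\<^sub>F y in nhds x. B y = 0"
      using eventually_nhds_in_open[of "{..<0}" x] False
      by (auto elim!: eventually_mono simp: B0)
    then show ?thesis using False z
      by (subst DERIV_cong_ev[OF refl _ refl, of _ "\<lambda>x. 0"]) auto
  qed
  have smB: "smooth B" using smooth_has_real_derivative[OF deriv b] .
  have mono: "B x \<le> B y" if "x \<le> y" for x y
    by (rule DERIV_nonneg_imp_nondecreasing[OF that]) (use deriv nn in blast)
  \<comment> \<open>A final value 0 would, by monotonicity, make \<open>B\<close> vanish on the unit
    interval, and then \<open>b (1/2)\<close> would be 0.\<close>
  have pos: "B 1 > 0"
  proof (rule ccontr)
    assume "\<not> B 1 > 0"
    then have "B x = 0" if "x \<in> {0..1}" for x
      using mono[of 0 x] mono[of x 1] B0[of 0] that by auto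
    then have "\<forall>\<^sub>F y in nhds (1/2). B y = 0"
      using eventually_nhds_in_open[of "{0<..<1}" "1/2 :: real"] by (auto elim!: eventually_mono)
    then have "(B has_real_derivative 0) (at (1/2))"
      by (subst DERIV_cong_ev[OF refl _ refl, of _ "\<lambda>x. 0"]) auto
    then have "b (1/2) = 0" using deriv DERIV_unique by blast
    then show False by (simp add: b_def flat_fun_def)
  qed
  show ?thesis
  proof
    show "smooth (\<lambda>x. inverse (B 1) * B x)" by (intro smooth_mult smooth_const smB)
    show "inverse (B 1) * B x \<ge> 0" for x
      using pos B0[of 0] B0[of x] mono[of 0 x] by (cases "x \<ge> 0") auto
    show "x \<le> 0 \<Longrightarrow> inverse (B 1) * B x = 0" for x using B0 by simp
    show "x \<ge> 1 \<Longrightarrow> inverse (B 1) * B x = 1" for x using B1[of x] pos by auto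
  qed
qed

lemma smooth_cutoff:
  fixes c :: "'a::euclidean_space" and r :: real
  assumes "r > 0"
  obtains w :: "'a \<Rightarrow> real"
  where "smooth w" and "\<And>x. w x \<ge> 0"
    and "\<And>x. dist c x \<le> r \<Longrightarrow> w x = 1" and "\<And>x. dist c x \<ge> 2 * r \<Longrightarrow> w x = 0"
proof -
  obtain H :: "real \<Rightarrow> real" where H: "smooth H" "\<And>x. H x \<ge> 0" "\<And>x. x \<le> 0 \<Longrightarrow> H x = 0"
    "\<And>x. x \<ge> 1 \<Longrightarrow> H x = 1" by (rule smooth_step) auto
  \<comment> \<open>The squared distance is smooth even at the centre. \<open>q\<close> is at least
    1 on the ball of radius \<open>r\<close> and at most -2 from distance \<open>2 * r\<close>
    on.\<close>
  define q where "q x = 2 + (- inverse (r\<^sup>2)) * (x \<bullet> x + (-2 * (x \<bullet> c) + c \<bullet> c))" for x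
  have "smooth q"
    unfolding q_def[abs_def] by (intro smooth_add smooth_mult smooth_const smooth_inner_self smooth_linear bounded_linear_inner_left)
  have q: "q x = 2 - (dist c x / r)\<^sup>2" for x
    by (simp add: q_def dist_norm power_divide power2_norm_eq_inner inner_diff inner_commute field_simps)
  show ?thesis
  proof
    show "smooth (\<lambda>x. H (q x))" by (rule smooth_compose_real[OF H(1) \<open>smooth q\<close>])
    show "H (q x) \<ge> 0" for x by (rule H)
    show "H (q x) = 1" if "dist c x \<le> r" for x
    proof (rule H)
      have "(dist c x / r)\<^sup>2 \<le> 1" using that assms by (simp add: power_le_one)
      then show "q x \<ge> 1" by (simp add: q)
    qed
    show "H (q x) = 0" if "dist c x \<ge> 2 * r" for x
    proof (rule H)
      have "(dist c x / r)\<^sup>2 \<ge> 2\<^sup>2" using that assms by (intro power_mono) (auto simp: field_simps)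
      then show "q x \<le> 0" by (simp add: q)
    qed
  qed
qed

section \<open>The exponential weight on a ball\<close>

lemma nn_integral_gaussian:
  assumes "r > 0"
  shows "(\<integral>\<^sup>+x. ennreal (exp (- x\<^sup>2 / (4 * r))) \<partial>lborel) = ennreal (sqrt (4 * pi * r))"
proof -
  define s where "s = sqrt (2 * r)"
  have s: "s > 0" "s\<^sup>2 = 2 * r" using assms by (auto simp: s_def)
  have "exp (- x\<^sup>2 / (4 * r)) = sqrt (4 * pi * r) * normal_density 0 s x" for x
    using assms by (simp add: normal_density_def s mult.assoc)
  then have "(\<integral>\<^sup>+x. ennreal (exp (- x\<^sup>2 / (4 * r))) \<partial>lborel)
      = ennreal (sqrt (4 * pi * r)) * (\<integral>\<^sup>+x. ennreal (normal_density 0 s x) \<partial>lborel)"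
    using assms by (simp add: ennreal_mult nn_integral_cmult)
  also have "(\<integral>\<^sup>+x. ennreal (normal_density 0 s x) \<partial>lborel) = 1"
    using s by (subst nn_integral_eq_integral) (auto simp: integral_normal_density)
  finally show ?thesis by simp
qed

text \<open>On the ball of radius \<open>r\<close> write \<open>x = x\<^sub>1 w + y\<close>. Then \<open>|y|\<^sup>2 \<le> r\<^sup>2 - x\<^sub>1\<^sup>2 \<le> 2 r (r - x\<^sub>1)\<close>, which
  leaves a Gaussian of variance of order \<open>r\<close> in the directions orthogonal to \<open>w\<close> and an
  exponential of unit scale along \<open>w\<close>.\<close>

lemma nn_integral_exp_inner_cball:
  fixes w :: "'a::euclidean_space"
  assumes w: "w \<in> Basis" and r: "r > 0"
  shows "(\<integral>\<^sup>+x. ennreal (exp (x \<bullet> w) * indicator (cball 0 r) x) \<partial>lborel)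
    \<le> ennreal (2 * exp r * sqrt (4 * pi * r) ^ (DIM('a) - 1))"
proof -
  \<comment> \<open>One-variable factors, so that the dominating integral splits into a product. The
    cut at \<open>r\<close> makes the growing factor along \<open>w\<close> integrable.\<close>
  define k where "k b y = (if b = w then exp ((y - r) / 2) * indicator {..r} y else exp (- y\<^sup>2 / (4 * r)))"
    for b :: 'a and y :: real
  have k0: "k b y \<ge> 0" for b y by (simp add: k_def)
  have [measurable]: "k b \<in> borel_measurable borel" for b
    unfolding k_def[abs_def] by (cases "b = w") simp_all
  have prod: "(\<Prod>b\<in>Basis. k b (x \<bullet> b))
      = exp ((x \<bullet> w - r) / 2) * indicator {..r} (x \<bullet> w) * exp (- (\<Sum>b\<in>Basis - {w}. (x \<bullet> b)\<^sup>2) / (4 * r))" for x :: 'a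
  proof -
    have "(\<Prod>b\<in>Basis. k b (x \<bullet> b)) = k w (x \<bullet> w) * (\<Prod>b\<in>Basis - {w}. k b (x \<bullet> b))"
      using w by (simp add: prod.remove)
    also have "(\<Prod>b\<in>Basis - {w}. k b (x \<bullet> b)) = (\<Prod>b\<in>Basis - {w}. exp (- (x \<bullet> b)\<^sup>2 / (4 * r)))"
      by (intro prod.cong) (auto simp: k_def)
    also have "\<dots> = exp (- (\<Sum>b\<in>Basis - {w}. (x \<bullet> b)\<^sup>2) / (4 * r))"
      by (simp add: exp_sum[symmetric] sum_negf[symmetric] sum_divide_distrib)
    finally show ?thesis by (simp add: k_def)
  qed
  have le: "exp (x \<bullet> w) * indicator (cball 0 r) x \<le> exp r * (\<Prod>b\<in>Basis. k b (x \<bullet> b))" for x :: 'a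
  proof (cases "x \<in> cball 0 r")
    case True
    define z where "z = x \<bullet> w"
    define Y where "Y = (\<Sum>b\<in>Basis - {w}. (x \<bullet> b)\<^sup>2)"
    have "(norm x)\<^sup>2 = (\<Sum>b\<in>Basis. (x \<bullet> b)\<^sup>2)"
      by (simp add: power2_norm_eq_inner euclidean_inner[of x x]) (simp add: power2_eq_square)
    also have "\<dots> = z\<^sup>2 + Y" using w by (simp add: sum.remove z_def Y_def)
    finally have "z\<^sup>2 + Y \<le> r\<^sup>2" using True power_mono[of "norm x" r 2] by simp
    have "\<bar>z\<bar> \<le> r" using Basis_le_norm[OF w, of x] True by (simp add: z_def)
    then have "z \<le> r" by simp
    have "Y \<le> 2 * r * (r - z)"
    proof -
      have "0 \<le> (r - z)\<^sup>2" by simp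
      then have "r\<^sup>2 - z\<^sup>2 \<le> 2 * r * (r - z)" by (simp add: power2_eq_square algebra_simps)
      with \<open>z\<^sup>2 + Y \<le> r\<^sup>2\<close> show ?thesis by simp
    qed
    \<comment> \<open>The deficit \<open>r - z\<close> is split in halves: one half pays for the
      Gaussian exponent \<open>Y / (4 * r)\<close>, the other remains as the exponential decay along
      \<open>w\<close>.\<close>
    then have "z \<le> r + (z - r) / 2 + - Y / (4 * r)" using r by (simp add: field_simps)
    then have "exp z \<le> exp r * (exp ((z - r) / 2) * exp (- Y / (4 * r)))"
      by (simp add: exp_add[symmetric] mult.assoc add.assoc del: exp_le_cancel_iff) (simp add: add.assoc)
    then show ?thesis using True \<open>z \<le> r\<close> by (simp add: prod z_def[symmetric] Y_def[symmetric])
  qed (use k0 in \<open>auto intro!: mult_nonneg_nonneg prod_nonneg\<close>)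
  have kw: "(\<integral>\<^sup>+y. ennreal (k w y) \<partial>lborel) = 2"
  proof -
    have "(\<integral>\<^sup>+y. ennreal (k w y) \<partial>lborel) = (\<integral>\<^sup>+y. ennreal (k w (r + (- 1) * y)) \<partial>lborel)"
      by (subst nn_integral_real_affine[of _ "- 1" r]) auto
    also have "\<dots> = (\<integral>\<^sup>+y. ennreal (exp (- y / 2)) * indicator {0..} y \<partial>lborel)"
      by (intro nn_integral_cong) (auto simp: k_def indicator_def)
    also have "\<dots> = ennreal (0 - (- 2 * exp (- 0 / 2)))"
    proof (rule nn_integral_FTC_atLeast)
      show "((\<lambda>y::real. - 2 * exp (- y / 2)) \<longlongrightarrow> 0) at_top" by real_asymp
    qed (auto intro!: derivative_eq_intros)
    finally show ?thesis by simp
  qed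
  have kb: "(\<integral>\<^sup>+y. ennreal (k b y) \<partial>lborel) = ennreal (sqrt (4 * pi * r))" if "b \<noteq> w" for b
    using that nn_integral_gaussian[OF r] by (simp add: k_def)
  have "(\<integral>\<^sup>+x. ennreal (exp (x \<bullet> w) * indicator (cball 0 r) x) \<partial>lborel)
      \<le> (\<integral>\<^sup>+x. ennreal (exp r) * (\<Prod>b\<in>Basis. ennreal (k b (x \<bullet> b))) \<partial>lborel)"
    using le by (intro nn_integral_mono) (simp add: prod_ennreal k0 ennreal_mult'[symmetric] ennreal_leI del: ennreal_mult')
  also have "\<dots> = ennreal (exp r) * (\<integral>\<^sup>+x. (\<Prod>b\<in>(Basis::'a set). ennreal (k b (x \<bullet> b))) \<partial>lborel)"
    by (rule nn_integral_cmult) simp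
  also have "(\<integral>\<^sup>+x. (\<Prod>b\<in>(Basis::'a set). ennreal (k b (x \<bullet> b))) \<partial>lborel) = (\<Prod>b\<in>(Basis::'a set). \<integral>\<^sup>+y. ennreal (k b y) \<partial>lborel)"
    by (rule nn_integral_lborel_prod) simp_all
  also have "\<dots> = 2 * (\<Prod>b\<in>(Basis::'a set) - {w}. \<integral>\<^sup>+y. ennreal (k b y) \<partial>lborel)"
    using w by (simp add: prod.remove kw)
  also have "(\<Prod>b\<in>(Basis::'a set) - {w}. \<integral>\<^sup>+y. ennreal (k b y) \<partial>lborel)
      = (\<Prod>b\<in>(Basis::'a set) - {w}. ennreal (sqrt (4 * pi * r)))"
    by (intro prod.cong) (auto simp: kb)
  also have "\<dots> = ennreal (sqrt (4 * pi * r) ^ (DIM('a) - 1))"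
    using w r by (simp add: card_Diff_singleton ennreal_power)
  also have "ennreal (exp r) * (2 * ennreal (sqrt (4 * pi * r) ^ (DIM('a) - 1)))
      = ennreal (2 * exp r * sqrt (4 * pi * r) ^ (DIM('a) - 1))"
    using r by (simp add: ennreal_mult ennreal_power mult_ac)
  finally show ?thesis .
qed

section \<open>The ordinary differential inequality\<close>

text \<open>Up to the first time at which \<open>F\<close> fails to be positive, \<open>U\<close> is
  nondecreasing, hence nonnegative. The integrating factor of the damping then makes
  \<open>M\<close> nondecreasing on that interval, so \<open>F\<close> is still positive at its
  end.\<close>

lemma ode_positivity:
  fixes F U N :: "real \<Rightarrow> real"
  assumes F: "continuous_on {0..<T} F" and U: "continuous_on {0..<T} U"
    and U': "\<And>t. t \<in> {0<..<T} \<Longrightarrow> (U has_real_derivative F t) (at t)"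
    and F': "\<And>t. t \<in> {0<..<T} \<Longrightarrow> (F has_real_derivative N t + U t - \<mu> / (1 + t) * F t) (at t)"
    and N: "\<And>t. t \<in> {0<..<T} \<Longrightarrow> N t \<ge> 0"
    and F0: "F 0 > 0" and U0: "U 0 \<ge> 0" and t: "t \<in> {0..<T}"
  shows "F t > 0 \<and> U t \<ge> 0"
proof -
  define M where "M s = (1 + s) powr \<mu> * F s" for s
  have M': "(M has_real_derivative (1 + s) powr \<mu> * (N s + U s)) (at s)" if "s \<in> {0<..<T}" for s
  proof -
    have "(M has_real_derivative \<mu> * (1 + s) powr (\<mu> - 1) * F s
        + (N s + U s - \<mu> / (1 + s) * F s) * (1 + s) powr \<mu>) (at s)"
      unfolding M_def[abs_def] using that
      by (auto intro!: derivative_eq_intros F')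
    moreover have "(1 + s) powr (\<mu> - 1) = (1 + s) powr \<mu> / (1 + s)"
      using that by (simp add: powr_diff)
    ultimately show ?thesis
      using that by (simp add: algebra_simps)
  qed
  have U_nonneg: "U s \<ge> 0" if "s \<in> {0..<T}" and "\<And>r. 0 < r \<Longrightarrow> r < s \<Longrightarrow> F r > 0" for s
  proof -
    have "U 0 \<le> U s"
    proof (rule DERIV_nonneg_imp_increasing_open[of 0 s U])
      show "continuous_on {0..s} U" by (rule continuous_on_subset[OF U]) (use that in auto)
      show "\<exists>y. (U has_real_derivative y) (at x) \<and> 0 \<le> y" if "0 < x" "x < s" for x
        using U'[of x] \<open>\<And>r. 0 < r \<Longrightarrow> r < s \<Longrightarrow> F r > 0\<close>[of x] that \<open>s \<in> _\<close> by (intro exI[of _ "F x"]) auto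
    qed (use that in auto)
    with U0 show ?thesis by simp
  qed
  have F_pos: "F t > 0" if t: "t \<in> {0..<T}" for t
  proof (rule ccontr)
    assume "\<not> F t > 0"
    define S where "S = {s \<in> {0..t}. F s \<le> 0}"
    have cont: "continuous_on {0..t} F" by (rule continuous_on_subset[OF F]) (use t in auto)
    have "closed S"
      unfolding S_def by (intro continuous_closed_preimage_constant continuous_on_closed_Collect_le cont) auto
    then have "compact S"
      by (auto simp: compact_eq_bounded_closed S_def intro: bounded_subset[OF bounded_closed_interval[of 0 t]])
    moreover have "t \<in> S" using \<open>\<not> F t > 0\<close> t by (auto simp: S_def)
    ultimately obtain s where s: "s \<in> S" "\<And>r. r \<in> S \<Longrightarrow> s \<le> r"
      using compact_attains_inf[of S] by blast
    have "s > 0" using s(1) F0 by (cases "s = 0") (auto simp: S_def)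
    have sT: "s \<in> {0..<T}" and sF: "F s \<le> 0" using s(1) t by (auto simp: S_def)
    have pos: "F r > 0" if "0 \<le> r" "r < s" for r
      using s(2)[of r] s(1) that by (cases "F r \<le> 0") (auto simp: S_def)
    have "M 0 \<le> M s"
    proof (rule DERIV_nonneg_imp_increasing_open[of 0 s M])
      show "continuous_on {0..s} M"
        unfolding M_def[abs_def]
        by (intro continuous_intros continuous_on_subset[OF F]) (use sT in auto)
      show "\<exists>y. (M has_real_derivative y) (at x) \<and> 0 \<le> y" if "0 < x" "x < s" for x
        using that sT pos U_nonneg[of x] N[of x]
        by (intro exI[of _ "(1 + x) powr \<mu> * (N x + U x)"] conjI M') auto
    qed (use \<open>s > 0\<close> in auto)
    moreover have "M 0 > 0" using F0 by (simp add: M_def)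
    moreover have "M s \<le> 0" using sF by (simp add: M_def mult_nonneg_nonpos)
    ultimately show False by simp
  qed
  show ?thesis using F_pos U_nonneg t by auto
qed

text \<open>\<open>H\<close> is a minorant of \<open>G\<close> with
  \<open>H' \<ge> (c / 2) (1 + t)^(- a) H^p\<close>. Dividing by \<open>H^p\<close> and integrating
  bounds the growth of \<open>A\<close>, because \<open>H^(1 - p)\<close> cannot drop below 0.
  Leaving the primitive \<open>A\<close> abstract treats \<open>a < 1\<close> and
  \<open>a = 1\<close> at once.\<close>

lemma ode_lifespan_from:
  fixes F U N A :: "real \<Rightarrow> real" and p \<mu> a c T d t :: real
  defines "m \<equiv> \<lambda>t. (1 + t) powr \<mu> * exp (- t)"
  assumes "\<mu> \<ge> 0" "p > 1" "c > 0"
    and U': "\<And>t. t \<in> {0<..<T} \<Longrightarrow> (U has_real_derivative F t) (at t)"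
    and F': "\<And>t. t \<in> {0<..<T} \<Longrightarrow> (F has_real_derivative N t + U t - \<mu> / (1 + t) * F t) (at t)"
    and N: "continuous_on {0<..<T} N"
    and N_ge: "\<And>t. t \<in> {0<..<T} \<Longrightarrow> m t * N t \<ge> c * (1 + t) powr (- a) * (m t * F t) powr p"
    and F0: "\<And>t. t \<in> {0<..<T} \<Longrightarrow> F t > 0" and U0: "\<And>t. t \<in> {0<..<T} \<Longrightarrow> U t \<ge> 0"
    and A: "\<And>t. t > 0 \<Longrightarrow> (A has_real_derivative (1 + t) powr (- a)) (at t)"
    and d: "0 < d" "d < t" "t < T"
  shows "(p - 1) * c / 2 * (A t - A d) \<le> (m d * F d / 2) powr (1 - p)"
proof -
  define G where "G s = m s * F s" for s
  define K where "K s = m s * U s" for s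
  define J where "J s = integral {d..s} (\<lambda>s. m s * N s)" for s
  \<comment> \<open>Half of the lower bound for \<open>G + K\<close>: inserting
    \<open>K \<ge> 2 H - G\<close> gives \<open>G' \<ge> m N - 2 (G - H)\<close>, and
    \<open>H' = m N / 2\<close> uses up only half of the source term.\<close>
  define H where "H s = (G d + J s) / 2" for s
  have m': "(m has_real_derivative (\<mu> / (1 + s) - 1) * m s) (at s)" if "s > 0" for s
  proof -
    have "(m has_real_derivative \<mu> * (1 + s) powr (\<mu> - 1) * exp (- s) - exp (- s) * (1 + s) powr \<mu>) (at s)"
      unfolding m_def using that by (auto intro!: derivative_eq_intros)
    moreover have "(1 + s) powr (\<mu> - 1) = (1 + s) powr \<mu> / (1 + s)"
      using that by (simp add: powr_diff)
    ultimately show ?thesis by (simp add: m_def algebra_simps)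
  qed
  have mpos: "m s > 0" if "s > 0" for s using that by (simp add: m_def)
  have G': "(G has_real_derivative m s * N s + K s - G s) (at s)" if "s \<in> {0<..<T}" for s
    unfolding G_def[abs_def] K_def using that
    by (auto intro!: derivative_eq_intros m' F' simp: algebra_simps)
  have K': "(K has_real_derivative G s - K s + \<mu> / (1 + s) * K s) (at s)" if "s \<in> {0<..<T}" for s
    unfolding K_def[abs_def] G_def using that
    by (auto intro!: derivative_eq_intros m' U' simp: algebra_simps)
  have contN: "continuous_on {d..b} (\<lambda>s. m s * N s)" if "b < T" for b
    unfolding m_def by (intro continuous_intros continuous_on_subset[OF N]) (use that d in auto)
  have J': "(J has_real_derivative m s * N s) (at s)" if "s \<in> {d<..<T}" for s
  proof -
    \<comment> \<open>An end point strictly between \<open>s\<close> and \<open>T\<close> keeps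
      \<open>s\<close> interior and stays where \<open>N\<close> is continuous.\<close>
    define b where "b = (s + T) / 2"
    have b: "s < b" "b < T" using that by (auto simp: b_def)
    have "(J has_real_derivative m s * N s) (at s within {d..b})"
      unfolding J_def[abs_def]
      by (rule integral_has_real_derivative[OF contN[OF b(2)]]) (use that b in auto)
    then show ?thesis using that b by (simp add: at_within_Icc_at)
  qed
  have contJ: "continuous_on {d..b} J" if "b < T" for b
    unfolding J_def
    by (intro indefinite_integral_continuous_1 integrable_continuous_interval contN that)
  have contG: "continuous_on {d..b} G" and contK: "continuous_on {d..b} K" if "b < T" for b
    using that d by (auto intro!: DERIV_continuous_on has_field_derivative_at_within[OF G']
        has_field_derivative_at_within[OF K'])
  have N0: "m s * N s \<ge> 0" if "s \<in> {0<..<T}" for s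
    using N_ge[OF that] \<open>c > 0\<close> by (smt (verit) mult_nonneg_nonneg powr_ge_zero)
  have Jd: "J d = 0" by (simp add: J_def)
  have GK: "G d + J s \<le> G s + K s" if s: "d \<le> s" "s < T" for s
  proof -
    have "G d + K d - J d \<le> G s + K s - J s"
    proof (rule DERIV_nonneg_imp_increasing_open[of d s "\<lambda>s. G s + K s - J s"])
      show "continuous_on {d..s} (\<lambda>s. G s + K s - J s)"
        by (intro continuous_intros contG contK contJ s)
      show "\<exists>y. ((\<lambda>s. G s + K s - J s) has_real_derivative y) (at x) \<and> 0 \<le> y" if "d < x" "x < s" for x
      proof (intro exI conjI)
        show "((\<lambda>s. G s + K s - J s) has_real_derivative
            (m x * N x + K x - G x) + (G x - K x + \<mu> / (1 + x) * K x) - m x * N x) (at x)"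
          by (intro DERIV_add DERIV_diff G' K' J') (use that s d in auto)
        have "K x \<ge> 0" using that s d mpos[of x] U0[of x] by (simp add: K_def)
        then show "0 \<le> (m x * N x + K x - G x) + (G x - K x + \<mu> / (1 + x) * K x) - m x * N x"
          using that d \<open>\<mu> \<ge> 0\<close> by simp
      qed
    qed (use s in auto)
    moreover have "K d \<ge> 0" using d mpos[of d] U0[of d] by (simp add: K_def)
    ultimately show ?thesis by (simp add: Jd)
  qed
  have J0: "J s \<ge> 0" if s: "d \<le> s" "s < T" for s
    unfolding J_def using d s N0
    by (intro integral_nonneg integrable_continuous_interval contN) auto
  have Gd: "G d > 0" using d mpos[of d] F0[of d] by (simp add: G_def)
  have Hpos: "H s > 0" if "d \<le> s" "s < T" for s
    using J0[OF that] Gd by (simp add: H_def)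
  \<comment> \<open>\<open>(G - H)' + 2 (G - H) \<ge> 0\<close>, hence \<open>exp (2 s) (G s - H s)\<close> is nondecreasing.\<close>
  have GH: "H s \<le> G s" if s: "d \<le> s" "s < T" for s
  proof -
    have "exp (2 * d) * (G d - H d) \<le> exp (2 * s) * (G s - H s)"
    proof (rule DERIV_nonneg_imp_increasing_open[of d s "\<lambda>s. exp (2 * s) * (G s - H s)"])
      show "continuous_on {d..s} (\<lambda>s. exp (2 * s) * (G s - H s))"
        unfolding H_def by (intro continuous_intros contG contJ s) auto
      show "\<exists>y. ((\<lambda>s. exp (2 * s) * (G s - H s)) has_real_derivative y) (at x) \<and> 0 \<le> y"
        if "d < x" "x < s" for x
      proof (intro exI conjI)
        show "((\<lambda>s. exp (2 * s) * (G s - H s)) has_real_derivative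
          exp (2 * x) * (2 * (G x - H x) + (m x * N x + K x - G x) - m x * N x / 2)) (at x)"
          unfolding H_def using that s d
          by (auto intro!: derivative_eq_intros G' J' simp: field_simps)
        have "0 \<le> 2 * (G x - H x) + (m x * N x + K x - G x) - m x * N x / 2"
          using GK[of x] N0[of x] that s d by (simp add: H_def field_simps)
        then show "0 \<le> exp (2 * x) * (2 * (G x - H x) + (m x * N x + K x - G x) - m x * N x / 2)"
          by simp
      qed
    qed (use s in auto)
    moreover have "G d - H d \<ge> 0" using Gd by (simp add: H_def Jd)
    ultimately have "0 \<le> exp (2 * s) * (G s - H s)"
      by (smt (verit) exp_gt_zero mult_nonneg_nonneg)
    then show ?thesis by (simp add: zero_le_mult_iff)
  qed
  have "H t powr (1 - p) + (p - 1) * c / 2 * A t \<le> H d powr (1 - p) + (p - 1) * c / 2 * A d"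
  proof (rule DERIV_nonpos_imp_decreasing_open[of d t "\<lambda>s. H s powr (1 - p) + (p - 1) * c / 2 * A s"])
    have "continuous_on {d..t} A"
      by (rule DERIV_continuous_on[OF has_field_derivative_at_within[OF A]]) (use d in auto)
    then show "continuous_on {d..t} (\<lambda>s. H s powr (1 - p) + (p - 1) * c / 2 * A s)"
      using Hpos d unfolding H_def by (intro continuous_intros contJ) (auto simp: less_imp_neq[symmetric] H_def)
    show "\<exists>y. ((\<lambda>s. H s powr (1 - p) + (p - 1) * c / 2 * A s) has_real_derivative y) (at x) \<and> y \<le> 0"
      if "d < x" "x < t" for x
    proof (intro exI conjI)
      have x: "x \<in> {0<..<T}" using that d by auto
      have Hx: "H x > 0" using Hpos that d by simp
      have H': "(H has_real_derivative m x * N x / 2) (at x)"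
        unfolding H_def using that d by (auto intro!: derivative_eq_intros J')
      show "((\<lambda>s. H s powr (1 - p) + (p - 1) * c / 2 * A s) has_real_derivative
          (1 - p) * H x powr (1 - p - 1) * (m x * N x / 2) + (p - 1) * c / 2 * (1 + x) powr (- a)) (at x)"
        using Hx x by (auto intro!: derivative_eq_intros H' A)
      have "c * (1 + x) powr (- a) * H x powr p \<le> c * (1 + x) powr (- a) * G x powr p"
        using GH[of x] Hx that d \<open>c > 0\<close> \<open>p > 1\<close> by (intro mult_left_mono powr_mono2) auto
      also have "\<dots> \<le> m x * N x" using N_ge[OF x] by (simp add: G_def)
      finally have "H x powr (- p) * (c * (1 + x) powr (- a) * H x powr p) \<le> H x powr (- p) * (m x * N x)"
        by (intro mult_left_mono) auto
      moreover have "H x powr (- p) * H x powr p = 1"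
        using Hx by (simp add: powr_add[symmetric])
      ultimately have "c * (1 + x) powr (- a) \<le> H x powr (- p) * (m x * N x)"
        by (simp add: mult_ac) (metis mult.assoc mult.commute mult.right_neutral)
      then have "(p - 1) * (c * (1 + x) powr (- a)) \<le> (p - 1) * (H x powr (- p) * (m x * N x))"
        using \<open>p > 1\<close> by (intro mult_left_mono) auto
      then show "(1 - p) * H x powr (1 - p - 1) * (m x * N x / 2) + (p - 1) * c / 2 * (1 + x) powr (- a) \<le> 0"
        by (simp add: field_simps)
    qed
  qed (use d in auto)
  moreover have "H t powr (1 - p) \<ge> 0" by simp
  ultimately have "(p - 1) * c / 2 * (A t - A d) \<le> H d powr (1 - p)"
    unfolding right_diff_distrib by linarith
  then show ?thesis by (simp add: H_def Jd G_def)
qed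

text \<open>\<open>N\<close> need not be integrable at \<open>0\<close>, so the estimate is first proved from a positive time.\<close>

lemma ode_lifespan:
  fixes F U N A :: "real \<Rightarrow> real" and p \<mu> a c T t :: real
  defines "m \<equiv> \<lambda>t. (1 + t) powr \<mu> * exp (- t)"
  assumes "\<mu> \<ge> 0" "p > 1" "c > 0"
    and F: "continuous_on {0..<T} F" and U: "continuous_on {0..<T} U"
    and U': "\<And>t. t \<in> {0<..<T} \<Longrightarrow> (U has_real_derivative F t) (at t)"
    and F': "\<And>t. t \<in> {0<..<T} \<Longrightarrow> (F has_real_derivative N t + U t - \<mu> / (1 + t) * F t) (at t)"
    and N: "continuous_on {0<..<T} N" and N0: "\<And>t. t \<in> {0<..<T} \<Longrightarrow> N t \<ge> 0"
    and N_ge: "\<And>t. t \<in> {0<..<T} \<Longrightarrow> F t > 0 \<Longrightarrow> m t * N t \<ge> c * (1 + t) powr (- a) * (m t * F t) powr p"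
    and F0: "F 0 > 0" and U0: "U 0 \<ge> 0"
    and A: "\<And>t. t \<ge> 0 \<Longrightarrow> (A has_real_derivative (1 + t) powr (- a)) (at t)"
    and t: "0 < t" "t < T"
  shows "(p - 1) * c / 2 * (A t - A 0) \<le> (F 0 / 2) powr (1 - p)"
proof -
  \<comment> \<open>Positivity comes first, because \<open>N_ge\<close> is available only at times
    where \<open>F\<close> is positive.\<close>
  have pos: "F t > 0 \<and> U t \<ge> 0" if "t \<in> {0..<T}" for t
    by (rule ode_positivity[OF F U U' F' N0 F0 U0 that])
  have "(p - 1) * c / 2 * (A t - A d) \<le> (m d * F d / 2) powr (1 - p)" if "0 < d" "d < t" for d
    unfolding m_def
    by (rule ode_lifespan_from[OF \<open>\<mu> \<ge> 0\<close> \<open>p > 1\<close> \<open>c > 0\<close> U' F' N N_ge[unfolded m_def] _ _ A])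
      (use pos that t in auto)
  then have "\<forall>\<^sub>F d in at_right 0. (p - 1) * c / 2 * (A t - A d) \<le> (m d * F d / 2) powr (1 - p)"
    using t eventually_at_right_field[of _ "0::real"] by blast
  moreover have "((\<lambda>d. (p - 1) * c / 2 * (A t - A d)) \<longlongrightarrow> (p - 1) * c / 2 * (A t - A 0)) (at_right 0)"
  proof -
    have "isCont A 0" using A DERIV_isCont by blast
    then have "(A \<longlongrightarrow> A 0) (at_right 0)"
      by (simp add: isCont_def filterlim_at_split)
    then show ?thesis by (intro tendsto_intros)
  qed
  moreover have "((\<lambda>d. (m d * F d / 2) powr (1 - p)) \<longlongrightarrow> (m 0 * F 0 / 2) powr (1 - p)) (at_right 0)"
  proof -
    have "(F \<longlongrightarrow> F 0) (at 0 within {0..t})"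
      by (rule tendsto_within_subset[where S = "{0..<T}"]) (use F t in \<open>auto simp: continuous_on_def\<close>)
    then have "(F \<longlongrightarrow> F 0) (at_right 0)"
      using t by (simp add: at_within_Icc_at_right)
    moreover have "((\<lambda>d. m d) \<longlongrightarrow> m 0) (at_right 0)"
      unfolding m_def by (intro tendsto_intros) auto
    ultimately show ?thesis
      using F0 by (intro tendsto_intros) (auto simp: m_def)
  qed
  ultimately have "(p - 1) * c / 2 * (A t - A 0) \<le> (m 0 * F 0 / 2) powr (1 - p)"
    using tendsto_le[OF trivial_limit_at_right_real] by blast
  then show ?thesis by (simp add: m_def)
qed

section \<open>Lebesgue spaces\<close>

text \<open>Convexity applied to the combination of \<open>\<bar>a\<bar> / (1 - \<theta>)\<close>
  and \<open>\<bar>b\<bar> / \<theta>\<close>. The free parameter is the point: as \<theta> tends to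
  0 the coefficient of \<open>\<bar>a\<bar> powr p\<close> tends to 1, which continuity of p-th
  power integrals requires. The choice \<open>\<theta> = 1/2\<close> gives the usual bound.\<close>

lemma powr_add_le_weighted:
  fixes a b p \<theta> :: real
  assumes p: "p \<ge> 1" and \<theta>: "0 < \<theta>" "\<theta> < 1"
  shows "\<bar>a + b\<bar> powr p \<le> (1 - \<theta>) powr (1 - p) * \<bar>a\<bar> powr p + \<theta> powr (1 - p) * \<bar>b\<bar> powr p"
proof -
  have ge1: "x powr (1 - p) \<ge> 1" if "0 < x" "x < 1" for x :: real
    using powr_mono'[of "1 - p" 0 x] that p by simp
  \<comment> \<open>Convexity of the power is used on positive arguments, so the zeros are split
    off; there both coefficients are at least 1.\<close>
  consider "a = 0" | "b = 0" | "a \<noteq> 0" "b \<noteq> 0" by blast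
  then show ?thesis
  proof cases
    case 1
    then show ?thesis using mult_right_mono[OF ge1[of \<theta>], of "\<bar>b\<bar> powr p"] \<theta> by simp
  next
    case 2
    then show ?thesis using mult_right_mono[OF ge1[of "1 - \<theta>"], of "\<bar>a\<bar> powr p"] \<theta> by simp
  next
    case 3
    define x where "x = \<bar>a\<bar> / (1 - \<theta>)"
    define y where "y = \<bar>b\<bar> / \<theta>"
    have xy: "x > 0" "y > 0" using 3 \<theta> by (auto simp: x_def y_def)
    have "\<bar>a + b\<bar> powr p \<le> ((1 - \<theta>) * x + \<theta> * y) powr p"
      using p \<theta> by (intro powr_mono2) (auto simp: x_def y_def)
    also have "\<dots> \<le> (1 - \<theta>) * x powr p + \<theta> * y powr p"
      using convex_onD[OF powr_convex[OF p], of \<theta> x y] xy \<theta> by simp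
    also have "(1 - \<theta>) * x powr p = (1 - \<theta>) powr (1 - p) * \<bar>a\<bar> powr p"
      using \<theta> by (simp add: x_def powr_divide powr_diff)
    also have "\<theta> * y powr p = \<theta> powr (1 - p) * \<bar>b\<bar> powr p"
      using \<theta> by (simp add: y_def powr_divide powr_diff)
    finally show ?thesis .
  qed
qed

lemma powr_tangent_le:
  fixes a y p :: real
  assumes "p \<ge> 1" "a > 0" "y \<ge> 0"
  shows "a powr p + p * a powr (p - 1) * (y - a) \<le> y powr p"
proof (cases "y = 0")
  case True
  have "a powr (p - 1) * a = a powr p" using assms by (simp add: powr_diff)
  then have "a powr p + p * a powr (p - 1) * (y - a) = (1 - p) * a powr p"
    using True by (simp add: algebra_simps)
  then show ?thesis using True assms by (simp add: mult_nonpos_nonneg)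
next
  case False
  have "y powr p - a powr p \<ge> p * a powr (p - 1) * (y - a)"
  proof (rule convex_on_imp_above_tangent[where A = "{0<..}"])
    show "convex_on {0<..} (\<lambda>x. x powr p)" by (rule powr_convex) fact
    show "((\<lambda>x. x powr p) has_real_derivative p * a powr (p - 1)) (at a within {0<..})"
      using assms by (auto intro!: derivative_eq_intros)
  qed (use assms False in \<open>auto simp: interior_open\<close>)
  then show ?thesis by simp
qed

lemma memLp_add:
  fixes h k :: "'a::euclidean_space \<Rightarrow> real"
  assumes p: "p \<ge> 1" and h: "memLp p h" and k: "memLp p k"
  shows "memLp p (\<lambda>x. h x + k x)"
proof -
  have [measurable]: "h \<in> borel_measurable lebesgue" "k \<in> borel_measurable lebesgue"
    using h k by (auto simp: memLp_def)
  define K where "K = (1 / 2 :: real) powr (1 - p)"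
  have "integrable lebesgue (\<lambda>x. K * norm (h x) powr p + K * norm (k x) powr p)"
    using h k by (auto simp: memLp_def)
  then have "integrable lebesgue (\<lambda>x. norm (h x + k x) powr p)"
  proof (rule Bochner_Integration.integrable_bound)
    show "AE x in lebesgue. norm (norm (h x + k x) powr p) \<le> norm (K * norm (h x) powr p + K * norm (k x) powr p)"
      using powr_add_le_weighted[OF p, of "1/2"] by (intro AE_I2) (auto simp: K_def abs_of_nonneg intro: order_trans)
  qed simp
  then show ?thesis by (simp add: memLp_def)
qed

lemma memLp_cmult:
  fixes h :: "'a::euclidean_space \<Rightarrow> real"
  assumes "memLp p h"
  shows "memLp p (\<lambda>x. c * h x)"
  using assms by (auto simp: memLp_def abs_mult powr_mult)

lemma memLp_diff:
  fixes h k :: "'a::euclidean_space \<Rightarrow> real"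
  assumes "p \<ge> 1" and "memLp p h" and "memLp p k"
  shows "memLp p (\<lambda>x. h x - k x)"
  using memLp_add[OF assms(1,2) memLp_cmult[OF assms(3), of "-1"]] by simp

section \<open>Pairing with a fixed square-integrable weight\<close>

lemma memLp_2_mult_integrable:
  fixes h k :: "'a::euclidean_space \<Rightarrow> real"
  assumes "memLp 2 h" "memLp 2 k"
  shows "integrable lebesgue (\<lambda>x. h x * k x)"
proof (rule Bochner_Integration.integrable_bound)
  show "integrable lebesgue (\<lambda>x. norm (h x) powr 2 + norm (k x) powr 2)"
    using assms by (auto simp: memLp_def)
  show "(\<lambda>x. h x * k x) \<in> borel_measurable lebesgue" using assms by (auto simp: memLp_def)
  have "\<bar>h x * k x\<bar> \<le> (h x)\<^sup>2 + (k x)\<^sup>2" for x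
    using sum_squares_bound[of "\<bar>h x\<bar>" "\<bar>k x\<bar>"] abs_ge_zero[of "h x * k x"]
    unfolding abs_mult power2_abs mult.assoc by linarith
  then show "AE x in lebesgue. norm (h x * k x) \<le> norm (norm (h x) powr 2 + norm (k x) powr 2)"
    by (intro AE_I2) simp
qed

text \<open>A crude form of Cauchy-Schwarz, from the pointwise bound
  \<open>\<bar>h k\<bar> \<le> h^2 / l + l k^2\<close>. It is enough for limits, since the
  right-hand side vanishes together with the L^2 norm of \<open>h\<close>.\<close>

lemma abs_integral_mult_le:
  fixes h k :: "'a::euclidean_space \<Rightarrow> real"
  assumes h: "memLp 2 h" and k: "memLp 2 k"
  shows "\<bar>\<integral>x. h x * k x \<partial>lebesgue\<bar> \<le> sqrt (\<integral>x. \<bar>h x\<bar> powr 2 \<partial>lebesgue) * (1 + (\<integral>x. \<bar>k x\<bar> powr 2 \<partial>lebesgue))"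
proof -
  define A where "A = (\<integral>x. \<bar>h x\<bar> powr 2 \<partial>lebesgue)"
  have ih: "integrable lebesgue (\<lambda>x. \<bar>h x\<bar> powr 2)" and ik: "integrable lebesgue (\<lambda>x. \<bar>k x\<bar> powr 2)"
    using h k by (auto simp: memLp_def)
  have "A \<ge> 0" by (simp add: A_def)
  show ?thesis
  proof (cases "A = 0")
    case True
    then have "AE x in lebesgue. \<bar>h x\<bar> powr 2 = 0"
      using integral_nonneg_eq_0_iff_AE[OF ih] by (simp add: A_def)
    then have "(\<integral>x. h x * k x \<partial>lebesgue) = 0"
      by (intro integral_eq_zero_AE) (auto elim: eventually_mono)
    then show ?thesis by simp
  next
    case False
    then have A: "A > 0" using \<open>A \<ge> 0\<close> by simp
    \<comment> \<open>With \<open>l\<close> the L^2 norm of \<open>h\<close>, the term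
      \<open>A / l\<close> equals \<open>l\<close>, so both parts carry the factor \<open>l\<close>;
      this is why norm 0 is a separate case.\<close>
    define l where "l = sqrt A"
    have l: "l > 0" "l * l = A" using A by (auto simp: l_def)
    have "\<bar>\<integral>x. h x * k x \<partial>lebesgue\<bar> \<le> (\<integral>x. \<bar>h x * k x\<bar> \<partial>lebesgue)"
      using integral_norm_bound[of lebesgue "\<lambda>x. h x * k x"] by simp
    also have "\<dots> \<le> (\<integral>x. \<bar>h x\<bar> powr 2 / l + l * \<bar>k x\<bar> powr 2 \<partial>lebesgue)"
    proof (rule integral_mono)
      show "integrable lebesgue (\<lambda>x. \<bar>h x * k x\<bar>)" using memLp_2_mult_integrable[OF h k] by simp
      show "\<bar>h x * k x\<bar> \<le> \<bar>h x\<bar> powr 2 / l + l * \<bar>k x\<bar> powr 2" for x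
      proof -
        have "0 \<le> (\<bar>h x\<bar> - l * \<bar>k x\<bar>)\<^sup>2 + l * \<bar>h x\<bar> * \<bar>k x\<bar>" using l by simp
        then have "l * (\<bar>h x\<bar> * \<bar>k x\<bar>) \<le> \<bar>h x\<bar>\<^sup>2 + l * l * \<bar>k x\<bar>\<^sup>2"
          by (simp add: power2_eq_square algebra_simps)
        then show ?thesis using l(1) by (simp add: field_simps abs_mult)
      qed
    qed (use ih ik in auto)
    also have "\<dots> = A / l + l * (\<integral>x. \<bar>k x\<bar> powr 2 \<partial>lebesgue)"
      using ih ik by (simp add: A_def)
    also have "A / l = l" using l by (simp add: field_simps)
    finally show ?thesis by (simp add: l_def A_def algebra_simps)
  qed
qed

lemma tendsto_integral_mult_L2:
  fixes h :: "'b \<Rightarrow> 'a::euclidean_space \<Rightarrow> real"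
  assumes k: "memLp 2 k" and h: "\<forall>\<^sub>F s in Z. memLp 2 (h s)" and l: "memLp 2 l"
    and lim: "((\<lambda>s. \<integral>x. \<bar>h s x - l x\<bar> powr 2 \<partial>lebesgue) \<longlongrightarrow> 0) Z"
  shows "((\<lambda>s. \<integral>x. h s x * k x \<partial>lebesgue) \<longlongrightarrow> (\<integral>x. l x * k x \<partial>lebesgue)) Z"
proof -
  have "((\<lambda>s. (\<integral>x. h s x * k x \<partial>lebesgue) - (\<integral>x. l x * k x \<partial>lebesgue)) \<longlongrightarrow> 0) Z"
  proof (rule Lim_null_comparison)
    show "((\<lambda>s. sqrt (\<integral>x. \<bar>h s x - l x\<bar> powr 2 \<partial>lebesgue) * (1 + (\<integral>x. \<bar>k x\<bar> powr 2 \<partial>lebesgue))) \<longlongrightarrow> 0) Z"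
      using tendsto_mult_left_zero[OF tendsto_real_sqrt[OF lim, unfolded real_sqrt_zero]] .
    show "\<forall>\<^sub>F s in Z. norm ((\<integral>x. h s x * k x \<partial>lebesgue) - (\<integral>x. l x * k x \<partial>lebesgue))
        \<le> sqrt (\<integral>x. \<bar>h s x - l x\<bar> powr 2 \<partial>lebesgue) * (1 + (\<integral>x. \<bar>k x\<bar> powr 2 \<partial>lebesgue))"
      using h
    proof eventually_elim
      case (elim s)
      have "(\<integral>x. h s x * k x \<partial>lebesgue) - (\<integral>x. l x * k x \<partial>lebesgue) = (\<integral>x. (h s x - l x) * k x \<partial>lebesgue)"
        using memLp_2_mult_integrable[OF elim k] memLp_2_mult_integrable[OF l k]
        by (simp add: left_diff_distrib)
      then show ?case
        using abs_integral_mult_le[OF memLp_diff[OF _ elim l] k] by simp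
    qed
  qed
  then show ?thesis by (simp add: LIM_zero_iff)
qed

lemma Lp_cont_on_2_integral:
  fixes h :: "real \<Rightarrow> 'a::euclidean_space \<Rightarrow> real"
  assumes "Lp_cont_on 2 S h" and "memLp 2 k"
  shows "continuous_on S (\<lambda>t. \<integral>x. h t x * k x \<partial>lebesgue)"
  unfolding continuous_on_def
proof
  fix t assume "t \<in> S"
  then show "((\<lambda>t. \<integral>x. h t x * k x \<partial>lebesgue) \<longlongrightarrow> (\<integral>x. h t x * k x \<partial>lebesgue)) (at t within S)"
    using assms by (intro tendsto_integral_mult_L2) (auto simp: Lp_cont_on_def eventually_at_filter)
qed

text \<open>Pairing with \<open>k\<close> is continuous on L^2, so it carries the L^2 limit of the
  difference quotients over to the integrals.\<close>

lemma Lp_deriv_on_2_integral: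
  fixes h :: "real \<Rightarrow> 'a::euclidean_space \<Rightarrow> real"
  assumes h: "Lp_cont_on 2 S h" "Lp_cont_on 2 S h'" "Lp_deriv_on 2 S h h'" and k: "memLp 2 k" and t: "t \<in> S"
  shows "((\<lambda>t. \<integral>x. h t x * k x \<partial>lebesgue) has_real_derivative (\<integral>x. h' t x * k x \<partial>lebesgue)) (at t within S)"
proof -
  have mem: "memLp 2 (h s)" "memLp 2 (h' s)" if "s \<in> S" for s
    using h that by (auto simp: Lp_cont_on_def)
  have quot: "memLp 2 (\<lambda>x. (h s x - h t x) / (s - t))" if "s \<in> S" for s
    using memLp_cmult[OF memLp_diff[OF _ mem(1)[OF that] mem(1)[OF t]], of "1 / (s - t)"] by simp
  have lim: "((\<lambda>s. \<integral>x. (h s x - h t x) / (s - t) * k x \<partial>lebesgue) \<longlongrightarrow> (\<integral>x. h' t x * k x \<partial>lebesgue)) (at t within S)"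
    using h t by (intro tendsto_integral_mult_L2 k mem(2))
      (auto simp: Lp_deriv_on_def eventually_at_filter quot)
  have "(\<integral>x. (h s x - h t x) / (s - t) * k x \<partial>lebesgue)
      = ((\<integral>x. h s x * k x \<partial>lebesgue) - (\<integral>x. h t x * k x \<partial>lebesgue)) / (s - t)" if "s \<in> S" for s
  proof -
    have "(\<integral>x. (h s x - h t x) / (s - t) * k x \<partial>lebesgue) = (\<integral>x. (h s x * k x - h t x * k x) / (s - t) \<partial>lebesgue)"
      by (simp add: left_diff_distrib)
    also have "\<dots> = (\<integral>x. h s x * k x - h t x * k x \<partial>lebesgue) / (s - t)"
      by simp
    finally show ?thesis
      using memLp_2_mult_integrable[OF mem(1)[OF that] k] memLp_2_mult_integrable[OF mem(1)[OF t] k]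
      by simp
  qed
  then have "\<forall>\<^sub>F s in at t within S. (\<integral>x. (h s x - h t x) / (s - t) * k x \<partial>lebesgue)
      = ((\<integral>x. h s x * k x \<partial>lebesgue) - (\<integral>x. h t x * k x \<partial>lebesgue)) / (s - t)"
    unfolding eventually_at_filter by (intro always_eventually allI impI)
  with lim show ?thesis
    unfolding has_field_derivative_iff by (rule Lim_transform_eventually)
qed

section \<open>Weighted integrals of p-th powers\<close>

lemma integrable_powr_weighted:
  fixes h k :: "'a::euclidean_space \<Rightarrow> real"
  assumes h: "memLp p h" and k: "k \<in> borel_measurable lebesgue" "\<And>x. \<bar>k x\<bar> \<le> B"
  shows "integrable lebesgue (\<lambda>x. \<bar>h x\<bar> powr p * k x)"
proof (rule Bochner_Integration.integrable_bound)
  show "integrable lebesgue (\<lambda>x. B * \<bar>h x\<bar> powr p)" using h by (simp add: memLp_def)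
  show "(\<lambda>x. \<bar>h x\<bar> powr p * k x) \<in> borel_measurable lebesgue" using h k by (auto simp: memLp_def)
  show "AE x in lebesgue. norm (\<bar>h x\<bar> powr p * k x) \<le> norm (B * \<bar>h x\<bar> powr p)"
  proof (rule AE_I2)
    fix x
    have "\<bar>k x\<bar> \<le> \<bar>B\<bar>" using k(2)[of x] by simp
    then show "norm (\<bar>h x\<bar> powr p * k x) \<le> norm (B * \<bar>h x\<bar> powr p)"
      by (simp add: abs_mult mult.commute[of "\<bar>h x\<bar> powr p"] mult_right_mono)
  qed
qed

text \<open>The weighted splitting compares the integrals at two times in both directions, with a
  factor close to 1 and an error proportional to the L^p distance. First \<theta> is chosen to bring
  the factor near 1, then the times are brought together.\<close>

lemma Lp_cont_on_powr_weighted: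
  fixes h :: "real \<Rightarrow> 'a::euclidean_space \<Rightarrow> real"
  assumes p: "p \<ge> 1" and h: "Lp_cont_on p S h"
    and k: "k \<in> borel_measurable lebesgue" "\<And>x. 0 \<le> k x" "\<And>x. k x \<le> B"
  shows "continuous_on S (\<lambda>t. \<integral>x. \<bar>h t x\<bar> powr p * k x \<partial>lebesgue)"
  unfolding continuous_on_def
proof
  fix t assume t: "t \<in> S"
  define N where "N s = (\<integral>x. \<bar>h s x\<bar> powr p * k x \<partial>lebesgue)" for s
  define D where "D s = (\<integral>x. \<bar>h s x - h t x\<bar> powr p \<partial>lebesgue)" for s
  have mem: "memLp p (h s)" if "s \<in> S" for s using h that by (auto simp: Lp_cont_on_def)
  have D: "(D \<longlongrightarrow> 0) (at t within S)" using h t by (simp add: Lp_cont_on_def D_def[abs_def])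
  have N0: "N s \<ge> 0" and D0: "D s \<ge> 0" for s using k by (simp_all add: N_def D_def)
  have int: "integrable lebesgue (\<lambda>x. \<bar>h s x\<bar> powr p * k x)" if "s \<in> S" for s
    by (rule integrable_powr_weighted[OF mem[OF that] k(1), of B]) (use k in auto)
  have B0: "B \<ge> 0" using k(2,3) order_trans by blast
  have step: "N r \<le> (1 - \<theta>) powr (1 - p) * N s + \<theta> powr (1 - p) * B * (\<integral>x. \<bar>h r x - h s x\<bar> powr p \<partial>lebesgue)"
    if \<theta>: "0 < \<theta>" "\<theta> < 1" and "r \<in> S" "s \<in> S" for r s \<theta>
  proof -
    have i: "integrable lebesgue (\<lambda>x. \<bar>h r x - h s x\<bar> powr p)"
      using memLp_diff[OF p mem[OF \<open>r \<in> S\<close>] mem[OF \<open>s \<in> S\<close>]] by (simp add: memLp_def)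
    have "N r \<le> (\<integral>x. (1 - \<theta>) powr (1 - p) * (\<bar>h s x\<bar> powr p * k x) + \<theta> powr (1 - p) * B * \<bar>h r x - h s x\<bar> powr p \<partial>lebesgue)"
      unfolding N_def
    proof (rule integral_mono)
      fix x
      have "\<bar>h r x\<bar> powr p * k x \<le> ((1 - \<theta>) powr (1 - p) * \<bar>h s x\<bar> powr p + \<theta> powr (1 - p) * \<bar>h r x - h s x\<bar> powr p) * k x"
        using powr_add_le_weighted[OF p \<theta>, of "h s x" "h r x - h s x"] k by (intro mult_right_mono) auto
      also have "\<dots> = (1 - \<theta>) powr (1 - p) * (\<bar>h s x\<bar> powr p * k x) + \<theta> powr (1 - p) * \<bar>h r x - h s x\<bar> powr p * k x"
        by (simp add: algebra_simps)
      also have "\<theta> powr (1 - p) * \<bar>h r x - h s x\<bar> powr p * k x \<le> \<theta> powr (1 - p) * \<bar>h r x - h s x\<bar> powr p * B"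
        using k by (intro mult_left_mono) auto
      finally show "\<bar>h r x\<bar> powr p * k x \<le> (1 - \<theta>) powr (1 - p) * (\<bar>h s x\<bar> powr p * k x) + \<theta> powr (1 - p) * B * \<bar>h r x - h s x\<bar> powr p"
        by (simp add: mult_ac)
    qed (use int i that in auto)
    also have "\<dots> = (1 - \<theta>) powr (1 - p) * N s + \<theta> powr (1 - p) * B * (\<integral>x. \<bar>h r x - h s x\<bar> powr p \<partial>lebesgue)"
      unfolding N_def using int i that by simp
    finally show ?thesis .
  qed
  have "(N \<longlongrightarrow> N t) (at t within S)"
  proof (rule tendstoI)
    fix e :: real assume "e > 0"
    define \<kappa> where "\<kappa> \<theta> = (1 - \<theta>) powr (1 - p)" for \<theta> :: real
    \<comment> \<open>Writing \<open>c\<close> for \<open>\<kappa> \<theta>\<close>, the worse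
      direction is \<open>N t - N s \<le> (c - 1) N s + K D s\<close>. Estimating \<open>N s\<close>
      once more by \<open>c N t + K D s\<close> gives \<open>(c - 1) c N t + c K D s\<close>, and
      each summand is kept below \<open>e / 2\<close>.\<close>
    have "((\<lambda>\<theta>. (\<kappa> \<theta> - 1) * \<kappa> \<theta> * N t) \<longlongrightarrow> (((1 - 0) powr (1 - p) - 1) * (1 - 0) powr (1 - p) * N t)) (at_right 0)"
      unfolding \<kappa>_def by (intro tendsto_intros) auto
    then have "\<forall>\<^sub>F \<theta> in at_right 0. (\<kappa> \<theta> - 1) * \<kappa> \<theta> * N t < e / 2"
      using \<open>e > 0\<close> by (intro order_tendstoD) auto
    moreover have "\<forall>\<^sub>F \<theta> in at_right 0. 0 < \<theta> \<and> \<theta> < (1::real)"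
      by (auto simp: eventually_at_right_field intro!: exI[of _ 1])
    ultimately have "\<forall>\<^sub>F \<theta> in at_right 0. (\<kappa> \<theta> - 1) * \<kappa> \<theta> * N t < e / 2 \<and> 0 < \<theta> \<and> \<theta> < 1"
      by eventually_elim auto
    then obtain \<theta> where \<theta>: "(\<kappa> \<theta> - 1) * \<kappa> \<theta> * N t < e / 2" "0 < \<theta>" "\<theta> < 1"
      using eventually_happens'[OF trivial_limit_at_right_real] by blast
    define c where "c = \<kappa> \<theta>"
    define K where "K = \<theta> powr (1 - p) * B"
    have c: "c \<ge> 1"
      using powr_mono'[of "1 - p" 0 "1 - \<theta>"] \<theta> p by (simp add: c_def \<kappa>_def)
    have K: "K \<ge> 0" using B0 by (simp add: K_def)
    have "((\<lambda>s. c * (K * D s)) \<longlongrightarrow> c * (K * 0)) (at t within S)"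
      by (intro tendsto_intros D)
    then have "\<forall>\<^sub>F s in at t within S. c * (K * D s) < e / 2"
      using \<open>e > 0\<close> by (intro order_tendstoD) auto
    moreover have "\<forall>\<^sub>F s in at t within S. s \<in> S" by (simp add: eventually_at_filter)
    ultimately show "\<forall>\<^sub>F s in at t within S. dist (N s) (N t) < e"
    proof eventually_elim
      case (elim s)
      have 1: "N s \<le> c * N t + K * D s"
        using step[OF \<theta>(2,3) elim(2) t] by (simp add: c_def \<kappa>_def K_def D_def)
      have 2: "N t \<le> c * N s + K * D s"
        using step[OF \<theta>(2,3) t elim(2)] by (simp add: c_def \<kappa>_def K_def D_def abs_minus_commute)
      have "K * D s \<le> c * (K * D s)"
        using mult_right_mono[OF c, of "K * D s"] K D0 by simp
      moreover have "(c - 1) * N t \<le> (c - 1) * c * N t"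
        using mult_left_mono[OF mult_right_mono[OF c N0[of t]], of "c - 1"] c by (simp add: mult.assoc)
      moreover have "(c - 1) * N s \<le> (c - 1) * (c * N t + K * D s)"
        using 1 c by (intro mult_left_mono) auto
      moreover have "(c - 1) * c * N t < e / 2" using \<theta>(1) by (simp add: c_def)
      moreover note 1 2 elim(1)
      ultimately have "N s - N t < e" "N t - N s < e"
        by (simp_all add: algebra_simps)
      then show ?case by (simp add: dist_real_def)
    qed
  qed
  then show "((\<lambda>t. \<integral>x. \<bar>h t x\<bar> powr p * k x \<partial>lebesgue) \<longlongrightarrow> (\<integral>x. \<bar>h t x\<bar> powr p * k x \<partial>lebesgue)) (at t within S)"
    by (simp add: N_def[abs_def])
qed

text \<open>Jensen's inequality, by integrating the tangent line of the power at the weighted mean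
  \<open>a = F / J\<close>: the linear term integrates to 0. Since \<open>1 - p\<close> is not
  positive, the mass \<open>J\<close> may be replaced by any upper bound.\<close>

lemma integral_powr_ge_powr_integral:
  fixes h k :: "'a::euclidean_space \<Rightarrow> real"
  assumes p: "p \<ge> 1" and k0: "\<And>x. 0 \<le> k x" and B: "B \<in> sets lebesgue"
    and supp: "AE x in lebesgue. x \<notin> B \<longrightarrow> h x = 0"
    and int: "integrable lebesgue (\<lambda>x. h x * k x)" "integrable lebesgue (\<lambda>x. \<bar>h x\<bar> powr p * k x)"
      "integrable lebesgue (\<lambda>x. k x * indicator B x)"
    and F: "(\<integral>x. h x * k x \<partial>lebesgue) > 0" and I: "(\<integral>x. k x * indicator B x \<partial>lebesgue) \<le> I"
  shows "I powr (1 - p) * (\<integral>x. h x * k x \<partial>lebesgue) powr p \<le> (\<integral>x. \<bar>h x\<bar> powr p * k x \<partial>lebesgue)"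
proof -
  define F where "F = (\<integral>x. h x * k x \<partial>lebesgue)"
  define J where "J = (\<integral>x. k x * indicator B x \<partial>lebesgue)"
  have "J \<ge> 0" using k0 by (simp add: J_def)
  \<comment> \<open>If the weight had no mass on \<open>B\<close>, then \<open>h k\<close> would
    vanish almost everywhere, contradicting a positive integral.\<close>
  have "J \<noteq> 0"
  proof
    assume "J = 0"
    then have "AE x in lebesgue. k x * indicator B x = 0"
      using integral_nonneg_eq_0_iff_AE[OF int(3)] k0 by (simp add: J_def)
    then have "AE x in lebesgue. h x * k x = 0"
      using supp by eventually_elim (auto simp: indicator_def split: if_splits)
    then have "F = 0" unfolding F_def by (rule integral_eq_zero_AE)
    then show False using F by (simp add: F_def)
  qed
  with \<open>J \<ge> 0\<close> have J: "J > 0" by simp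
  define a where "a = F / J"
  have a: "a > 0" using J F by (simp add: a_def F_def)
  have "a powr p * J + p * a powr (p - 1) * (F - a * J)
      = (\<integral>x. a powr p * (k x * indicator B x) + p * a powr (p - 1) * (h x * k x - a * (k x * indicator B x)) \<partial>lebesgue)"
    using int by (simp add: F_def J_def)
  also have "\<dots> \<le> (\<integral>x. \<bar>h x\<bar> powr p * k x \<partial>lebesgue)"
  proof (rule integral_mono_AE)
    show "AE x in lebesgue. a powr p * (k x * indicator B x) + p * a powr (p - 1) * (h x * k x - a * (k x * indicator B x))
        \<le> \<bar>h x\<bar> powr p * k x"
      using supp
    proof eventually_elim
      case (elim x)
      show ?case
      proof (cases "x \<in> B")
        case True
        have "a powr p + p * a powr (p - 1) * (h x - a) \<le> a powr p + p * a powr (p - 1) * (\<bar>h x\<bar> - a)"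
          using p by (intro add_left_mono mult_left_mono) auto
        also have "\<dots> \<le> \<bar>h x\<bar> powr p" by (rule powr_tangent_le[OF p a]) simp
        finally have "(a powr p + p * a powr (p - 1) * (h x - a)) * k x \<le> \<bar>h x\<bar> powr p * k x"
          by (rule mult_right_mono) (rule k0)
        then show ?thesis using True by (simp add: algebra_simps)
      qed (use elim in simp)
    qed
  qed (use int in auto)
  finally have le: "a powr p * J \<le> (\<integral>x. \<bar>h x\<bar> powr p * k x \<partial>lebesgue)"
    using J by (simp add: a_def)
  have "I powr (1 - p) * F powr p \<le> J powr (1 - p) * F powr p"
    using J I p by (intro mult_right_mono powr_mono2') (auto simp: J_def)
  also have "\<dots> = a powr p * J"
    using J F by (simp add: a_def F_def powr_divide powr_diff)
  finally show ?thesis using le by (simp add: F_def)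
qed

text \<open>For \<open>s\<close> slightly later than \<open>t\<close>, both \<open>h s\<close> and
  \<open>h t\<close> vanish beyond \<open>t + R'\<close>, hence so does their difference quotient.
  There the L^2 error of the quotient is the mass of \<open>h' t\<close> itself, and it tends to 0.
  The margin between \<open>R\<close> and \<open>R'\<close> leaves room for \<open>s > t\<close>;
  using later times only also covers \<open>t = 0\<close>.\<close>

lemma Lp_deriv_on_support:
  fixes h :: "real \<Rightarrow> 'a::euclidean_space \<Rightarrow> real"
  assumes h: "Lp_cont_on 2 {0..<T} h" "Lp_cont_on 2 {0..<T} h'" "Lp_deriv_on 2 {0..<T} h h'"
    and supp: "\<And>t. t \<in> {0..<T} \<Longrightarrow> AE x in lebesgue. t + R < norm x \<longrightarrow> h t x = 0"
    and t: "t \<in> {0..<T}" and R: "R < R'"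
  shows "AE x in lebesgue. t + R' < norm x \<longrightarrow> h' t x = 0"
proof -
  define B where "B = {x::'a. t + R' < norm x}"
  have B[measurable]: "B \<in> sets lebesgue"
  proof -
    have "open B" unfolding B_def by (intro open_Collect_less continuous_intros)
    then show ?thesis by simp
  qed
  have mem: "memLp 2 (h s)" "memLp 2 (h' s)" if "s \<in> {0..<T}" for s
    using h that by (auto simp: Lp_cont_on_def)
  define A where "A = (\<integral>x. \<bar>h' t x\<bar> powr 2 * indicator B x \<partial>lebesgue)"
  have iA: "integrable lebesgue (\<lambda>x. \<bar>h' t x\<bar> powr 2 * indicator B x)"
    by (rule integrable_powr_weighted[OF mem(2)[OF t], of _ 1]) (auto simp: indicator_def)
  define E where "E s = (\<integral>x. \<bar>(h s x - h t x) / (s - t) - h' t x\<bar> powr 2 \<partial>lebesgue)" for s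
  have "A \<le> E s" if s: "t < s" "s < T" "s < t + (R' - R)" for s
    unfolding A_def E_def
  proof (rule integral_mono_AE[OF iA])
    have sT: "s \<in> {0..<T}" using s t by auto
    have "memLp 2 (\<lambda>x. 1 / (s - t) * (h s x - h t x) - h' t x)"
      by (intro memLp_diff memLp_cmult mem sT t) auto
    then show "integrable lebesgue (\<lambda>x. \<bar>(h s x - h t x) / (s - t) - h' t x\<bar> powr 2)"
      by (simp add: memLp_def)
    show "AE x in lebesgue. \<bar>h' t x\<bar> powr 2 * indicator B x \<le> \<bar>(h s x - h t x) / (s - t) - h' t x\<bar> powr 2"
      using supp[OF sT] supp[OF t]
      by eventually_elim (use s R in \<open>auto simp: B_def indicator_def\<close>)
  qed
  then have "\<forall>\<^sub>F s in at_right t. A \<le> E s"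
    using t R eventually_at_right_field[of "\<lambda>s. A \<le> E s" t]
    by (auto intro!: exI[of _ "min T (t + (R' - R))"])
  moreover have "(E \<longlongrightarrow> 0) (at_right t)"
  proof -
    have "(E \<longlongrightarrow> 0) (at t within {0..<T})" using h t by (simp add: Lp_deriv_on_def E_def[abs_def])
    then have "(E \<longlongrightarrow> 0) (at t within {t..(t + T) / 2})"
      by (rule tendsto_within_subset) (use t in auto)
    then show ?thesis using t by (simp add: at_within_Icc_at_right)
  qed
  ultimately have "A \<le> 0"
    using tendsto_lowerbound[OF _ _ trivial_limit_at_right_real] by blast
  moreover have "A \<ge> 0" by (simp add: A_def)
  ultimately have "A = 0" by simp
  then have "AE x in lebesgue. \<bar>h' t x\<bar> powr 2 * indicator B x = 0"
    using integral_nonneg_eq_0_iff_AE[OF iA] by (simp add: A_def)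
  then show ?thesis
    by eventually_elim (auto simp: B_def indicator_def split: if_splits)
qed

section \<open>The weighted averages of an energy solution\<close>

lemma test_fun_bounded:
  assumes "test_fun \<psi>"
  shows "\<exists>B. \<forall>x. \<bar>\<psi> x\<bar> \<le> B"
proof -
  have "compact (\<psi> ` closure {x. \<psi> x \<noteq> 0})"
    using assms by (intro compact_continuous_image smooth_imp_continuous) (auto simp: test_fun_def)
  then obtain B where B: "\<And>y. y \<in> \<psi> ` closure {x. \<psi> x \<noteq> 0} \<Longrightarrow> norm y \<le> B"
    using compact_imp_bounded bounded_iff by metis
  have "\<bar>\<psi> x\<bar> \<le> max B 0" for x
    using B[of "\<psi> x"] closure_subset[of "{x. \<psi> x \<noteq> 0}"] by (cases "\<psi> x = 0") auto
  then show ?thesis by blast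
qed

lemma test_fun_measurable: "test_fun \<psi> \<Longrightarrow> \<psi> \<in> borel_measurable lebesgue"
  by (auto simp: test_fun_def intro!: borel_measurable_continuous_onI measurable_completion smooth_imp_continuous)

lemma test_fun_memLp:
  fixes \<psi> :: "'a::euclidean_space \<Rightarrow> real"
  assumes "test_fun \<psi>" "p > 0"
  shows "memLp p \<psi>"
proof -
  obtain B where B: "\<And>x. \<bar>\<psi> x\<bar> \<le> B" using test_fun_bounded[OF assms(1)] by blast
  define S where "S = closure {x. \<psi> x \<noteq> 0}"
  have S: "compact S" using assms by (simp add: S_def test_fun_def)
  note [measurable] = test_fun_measurable[OF assms(1)]
  have "integrable lebesgue (\<lambda>x. B powr p * indicator S x)"
    using S by (intro integrable_mult_right) (auto simp: emeasure_compact_finite intro!: integrable_real_indicator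
        fmeasurableD lmeasurable_compact dest: fmeasurableD2[OF lmeasurable_compact] simp: less_top[symmetric])
  then have "integrable lebesgue (\<lambda>x. norm (\<psi> x) powr p)"
  proof (rule Bochner_Integration.integrable_bound)
    show "AE x in lebesgue. norm (norm (\<psi> x) powr p) \<le> norm (B powr p * indicator S x)"
    proof (rule AE_I2)
      fix x
      show "norm (norm (\<psi> x) powr p) \<le> norm (B powr p * indicator S x)"
        using B[of x] closure_subset[of "{x. \<psi> x \<noteq> 0}"] assms(2)
        by (cases "\<psi> x = 0") (auto simp: S_def indicator_def intro!: powr_mono2)
    qed
  qed simp
  then show ?thesis by (simp add: memLp_def test_fun_measurable[OF assms(1)])
qed

lemma test_fun_partial:
  assumes "test_fun \<psi>" and "i \<in> Basis"
  shows "test_fun (\<lambda>x. frechet_derivative \<psi> (at x) i)"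
proof -
  have "frechet_derivative \<psi> (at x) i = 0" if "x \<notin> closure {x. \<psi> x \<noteq> 0}" for x
  proof -
    have "(\<psi> has_derivative (\<lambda>h. 0)) (at x)"
      by (rule has_derivative_transform_within_open[OF has_derivative_const[of 0]
            open_Compl[OF closed_closure[of "{x. \<psi> x \<noteq> 0}"]]])
        (use that closure_subset[of "{x. \<psi> x \<noteq> 0}"] in auto)
    then show ?thesis by (metis frechet_derivative_at)
  qed
  then have "{x. frechet_derivative \<psi> (at x) i \<noteq> 0} \<subseteq> closure {x. \<psi> x \<noteq> 0}" by blast
  then have "closure {x. frechet_derivative \<psi> (at x) i \<noteq> 0} \<subseteq> closure {x. \<psi> x \<noteq> 0}"
    by (rule closure_minimal) simp
  then show ?thesis
    using assms smooth_frechet(2) unfolding test_fun_def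
    by (metis closed_closure compact_Int_closed inf.absorb_iff2)
qed

lemma st_test_product:
  fixes \<Phi> :: "'a::euclidean_space \<Rightarrow> real"
  assumes \<Phi>: "test_fun \<Phi>" and \<eta>: "smooth \<eta>" and supp: "\<And>t. \<eta> t \<noteq> 0 \<Longrightarrow> t \<in> {a..b}" and b: "b < T"
  shows "st_test T (\<lambda>x t. \<eta> t * \<Phi> x)"
proof -
  let ?S = "{z::'a \<times> real. \<eta> (snd z) * \<Phi> (fst z) \<noteq> 0}"
  have cl: "closure ?S \<subseteq> closure {x. \<Phi> x \<noteq> 0} \<times> {a..b}"
  proof (rule closure_minimal)
    show "?S \<subseteq> closure {x. \<Phi> x \<noteq> 0} \<times> {a..b}"
      using supp closure_subset[of "{x. \<Phi> x \<noteq> 0}"] by auto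
  qed (auto intro: closed_Times)
  have "compact (closure {x. \<Phi> x \<noteq> 0} \<times> {a..b})"
    using \<Phi> by (auto simp: test_fun_def intro: compact_Times)
  from compact_Int_closed[OF this closed_closure[of ?S]] have "compact (closure ?S)"
    by (simp only: Int_absorb1[OF cl])
  moreover have "smooth (\<lambda>z::'a \<times> real. \<eta> (snd z) * \<Phi> (fst z))"
    using \<Phi> unfolding test_fun_def
    by (intro smooth_mult[OF smooth_compose_linear[OF \<eta> bounded_linear_snd] smooth_compose_linear[OF _ bounded_linear_fst]])
      blast
  moreover have "closure ?S \<subseteq> UNIV \<times> {..<T}" using cl b by fastforce
  ultimately show ?thesis by (simp add: st_test_def)
qed

text \<open>Partial derivatives of a test function are test functions again, so the weak gradient
  can be tested against them coordinate by coordinate. The iterated sum on the right is the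
  Laplacian of \<Phi>, and the result is Green's identity for a weak gradient.\<close>

lemma integral_grad_product:
  fixes \<Phi> h :: "'a::euclidean_space \<Rightarrow> real"
  assumes \<Phi>: "test_fun \<Phi>" and h: "memLp 2 h" and G: "memLp 2 G" and wg: "weak_grad h G"
  shows "integrable lebesgue (\<lambda>x. \<Sum>i\<in>Basis. (G x \<bullet> i) * frechet_derivative \<Phi> (at x) i)"
    and "(\<integral>x. (\<Sum>i\<in>Basis. (G x \<bullet> i) * frechet_derivative \<Phi> (at x) i) \<partial>lebesgue)
      = - (\<integral>x. h x * (\<Sum>i\<in>Basis. frechet_derivative (\<lambda>y. frechet_derivative \<Phi> (at y) i) (at x) i) \<partial>lebesgue)"
proof -
  define D where "D i x = frechet_derivative \<Phi> (at x) i" for i x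
  define DD where "DD i x = frechet_derivative (D i) (at x) i" for i x
  have D: "test_fun (D i)" if "i \<in> Basis" for i
    unfolding D_def[abs_def] by (rule test_fun_partial[OF \<Phi> that])
  have DD: "test_fun (DD i)" if "i \<in> Basis" for i
    unfolding DD_def[abs_def] by (rule test_fun_partial[OF D[OF that] that])
  have Gi: "memLp 2 (\<lambda>x. G x \<bullet> i)" if "i \<in> Basis" for i
  proof -
    have [measurable]: "G \<in> borel_measurable lebesgue" using G by (simp add: memLp_def)
    have "integrable lebesgue (\<lambda>x. norm (G x) powr 2)" using G by (simp add: memLp_def)
    then have "integrable lebesgue (\<lambda>x. norm (G x \<bullet> i) powr 2)"
    proof (rule Bochner_Integration.integrable_bound)
      show "AE x in lebesgue. norm (norm (G x \<bullet> i) powr 2) \<le> norm (norm (G x) powr 2)"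
        using Basis_le_norm[OF that] by (intro AE_I2) (auto intro!: powr_mono2 simp del: powr_numeral)
    qed simp
    then show ?thesis by (simp add: memLp_def)
  qed
  have int: "integrable lebesgue (\<lambda>x. (G x \<bullet> i) * D i x)" if "i \<in> Basis" for i
    by (rule memLp_2_mult_integrable[OF Gi test_fun_memLp[OF D]]) (use that in auto)
  have int2: "integrable lebesgue (\<lambda>x. h x * DD i x)" if "i \<in> Basis" for i
    by (rule memLp_2_mult_integrable[OF h test_fun_memLp[OF DD]]) (use that in auto)
  show "integrable lebesgue (\<lambda>x. \<Sum>i\<in>Basis. (G x \<bullet> i) * frechet_derivative \<Phi> (at x) i)"
    using int by (auto simp: D_def)
  have "(\<integral>x. (\<Sum>i\<in>Basis. (G x \<bullet> i) * D i x) \<partial>lebesgue) = (\<Sum>i\<in>Basis. \<integral>x. (G x \<bullet> i) * D i x \<partial>lebesgue)"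
    by (rule Bochner_Integration.integral_sum) (use int in auto)
  also have "\<dots> = (\<Sum>i\<in>Basis. - (\<integral>x. h x * DD i x \<partial>lebesgue))"
    using wg D by (intro sum.cong) (auto simp: weak_grad_def DD_def)
  also have "\<dots> = - (\<integral>x. (\<Sum>i\<in>Basis. h x * DD i x) \<partial>lebesgue)"
    by (subst Bochner_Integration.integral_sum) (use int2 in \<open>auto simp: sum_negf\<close>)
  finally show "(\<integral>x. (\<Sum>i\<in>Basis. (G x \<bullet> i) * frechet_derivative \<Phi> (at x) i) \<partial>lebesgue)
      = - (\<integral>x. h x * (\<Sum>i\<in>Basis. frechet_derivative (\<lambda>y. frechet_derivative \<Phi> (at y) i) (at x) i) \<partial>lebesgue)"
    by (simp add: D_def[abs_def] DD_def sum_distrib_left)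
qed

lemma sgrad_product:
  assumes "smooth \<Phi>"
  shows "w \<bullet> sgrad (\<lambda>x t. \<eta> t * \<Phi> x) x s = \<eta> s * (\<Sum>i\<in>Basis. (w \<bullet> i) * frechet_derivative \<Phi> (at x) i)"
proof -
  have "((\<lambda>y. \<eta> s * \<Phi> y) has_derivative (\<lambda>h. \<eta> s * frechet_derivative \<Phi> (at x) h)) (at x)"
    by (intro has_derivative_mult_right smooth_frechet(1) assms)
  then have "frechet_derivative (\<lambda>y. \<eta> s * \<Phi> y) (at x) = (\<lambda>h. \<eta> s * frechet_derivative \<Phi> (at x) h)"
    by (metis frechet_derivative_at)
  then show ?thesis
    by (simp add: sgrad_def inner_sum_right sum_distrib_left mult_ac)
qed

text \<open>The weak formulation is tested with \<open>\<eta> t * \<Phi> x\<close>, where \<eta>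
  equals 1 near \<open>t0\<close>. It then expresses \<open>\<eta> F\<close> as the integral of a
  continuous function, which can be differentiated at \<open>t0\<close>. The hypothesis
  \<open>lap\<close> asks for an eigenfunction of the Laplacian only where u is nonzero, so \<Phi>
  may be cut off elsewhere.\<close>

lemma energy_functional_derivative:
  fixes \<Phi> :: "'a::euclidean_space \<Rightarrow> real" and v u :: "'a \<Rightarrow> real \<Rightarrow> real" and Du :: "'a \<Rightarrow> real \<Rightarrow> 'a"
  assumes p: "p > 1"
    and wg: "\<forall>t\<in>{0..<T}. weak_grad (\<lambda>x. u x t) (\<lambda>x. Du x t)"
    and u: "Lp_cont_on 2 {0..<T} (\<lambda>t x. u x t)" and Du: "Lp_cont_on 2 {0..<T} (\<lambda>t x. Du x t)"
    and v: "Lp_cont_on 2 {0..<T} (\<lambda>t x. v x t)" and vp: "Lp_cont_on p {0<..<T} (\<lambda>t x. v x t)"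
    and weak: "\<forall>\<phi>. st_test T \<phi> \<longrightarrow> (\<forall>t\<in>{0..<T}.
        (\<integral>x. v x t * \<phi> x t \<partial>lebesgue) - (\<integral>x. v x 0 * \<phi> x 0 \<partial>lebesgue)
        + (LINT s:{0..t}|lborel. (\<integral>x. - v x s * deriv (\<lambda>r. \<phi> x r) s + Du x s \<bullet> sgrad \<phi> x s \<partial>lebesgue))
        + (LINT s:{0..t}|lborel. (\<integral>x. \<mu> * v x s / (1 + s) powr 1 * \<phi> x s \<partial>lebesgue))
        = (LINT s:{0..t}|lborel. (\<integral>x. \<bar>v x s\<bar> powr p * \<phi> x s \<partial>lebesgue)))"
    and \<Phi>: "test_fun \<Phi>" "\<And>x. 0 \<le> \<Phi> x"
    and lap: "\<And>t. t \<in> {0..<T} \<Longrightarrow> AE x in lebesgue.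
        u x t * (\<Sum>i\<in>Basis. frechet_derivative (\<lambda>y. frechet_derivative \<Phi> (at y) i) (at x) i) = u x t * \<Phi> x"
    and t0: "t0 \<in> {0<..<T}"
  shows "((\<lambda>t. \<integral>x. v x t * \<Phi> x \<partial>lebesgue) has_real_derivative
    (\<integral>x. \<bar>v x t0\<bar> powr p * \<Phi> x \<partial>lebesgue) + (\<integral>x. u x t0 * \<Phi> x \<partial>lebesgue)
      - \<mu> / (1 + t0) * (\<integral>x. v x t0 * \<Phi> x \<partial>lebesgue)) (at t0)"
proof -
  define F where "F t = (\<integral>x. v x t * \<Phi> x \<partial>lebesgue)" for t
  define U where "U t = (\<integral>x. u x t * \<Phi> x \<partial>lebesgue)" for t
  define N where "N t = (\<integral>x. \<bar>v x t\<bar> powr p * \<Phi> x \<partial>lebesgue)" for t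
  have \<Phi>2: "memLp 2 \<Phi>" using test_fun_memLp[OF \<Phi>(1)] by simp
  have sm: "smooth \<Phi>" using \<Phi> by (simp add: test_fun_def)
  obtain B where B: "\<And>x. \<bar>\<Phi> x\<bar> \<le> B" using test_fun_bounded[OF \<Phi>(1)] by blast
  have contF: "continuous_on {0..<T} F" unfolding F_def by (rule Lp_cont_on_2_integral[OF v \<Phi>2])
  have contU: "continuous_on {0..<T} U" unfolding U_def by (rule Lp_cont_on_2_integral[OF u \<Phi>2])
  have contN: "continuous_on {0<..<T} N"
    unfolding N_def
    by (rule Lp_cont_on_powr_weighted[OF _ vp test_fun_measurable[OF \<Phi>(1)], of B])
      (use p \<Phi> B abs_le_D1 in auto)
  \<comment> \<open>A third of the distance to the nearer end point: the plateau of \<eta> has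
    radius \<open>r\<close> and its support radius \<open>2 * r\<close>, which leaves a gap both at
    0 and at \<open>T\<close>.\<close>
  define r where "r = min t0 (T - t0) / 3"
  have r: "r > 0" "3 * r \<le> t0" "t0 + 3 * r \<le> T" using t0 by (auto simp: r_def)
  obtain \<eta> :: "real \<Rightarrow> real" where \<eta>: "smooth \<eta>" "\<And>x. \<eta> x \<ge> 0"
    "\<And>x. dist t0 x \<le> r \<Longrightarrow> \<eta> x = 1" "\<And>x. dist t0 x \<ge> 2 * r \<Longrightarrow> \<eta> x = 0"
    using smooth_cutoff[OF r(1)] by blast
  have \<eta>_supp: "t \<in> {t0 - 2 * r..t0 + 2 * r}" if "\<eta> t \<noteq> 0" for t
    using \<eta>(4)[of t] that by (cases "2 * r \<le> dist t0 t") (auto simp: dist_real_def)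
  define \<eta>' where "\<eta>' t = deriv \<eta> t" for t
  have \<eta>_deriv: "(\<eta> has_real_derivative \<eta>' t) (at t)" for t
    unfolding \<eta>'_def using smooth_frechet(1)[OF \<eta>(1), of t]
    by (metis DERIV_imp_deriv differentiable_def real_differentiableE)
  have cont\<eta>': "continuous_on S \<eta>'" for S
  proof -
    have "\<eta>' t = frechet_derivative \<eta> (at t) 1" for t
      using \<eta>_deriv[of t] by (simp add: has_field_derivative_def frechet_derivative_at[symmetric])
    then have "\<eta>' = (\<lambda>t. frechet_derivative \<eta> (at t) 1)" by blast
    then show ?thesis using smooth_frechet(2)[OF \<eta>(1), of 1] smooth_imp_continuous by simp
  qed
  have cont\<eta>: "continuous_on S \<eta>" for S by (rule smooth_imp_continuous[OF \<eta>(1)])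
  have "\<eta> 0 = 0" using \<eta>(4)[of 0] r by (simp add: dist_real_def)
  \<comment> \<open>\<open>N\<close> is continuous only for positive times, but \<eta> vanishes
    identically before time \<open>r\<close>, so the product extends continuously to 0.\<close>
  have cont\<eta>N: "continuous_on {0..<T} (\<lambda>s. \<eta> s * N s)"
  proof -
    have "continuous_on {..<r} (\<lambda>s. \<eta> s * N s)"
    proof (rule continuous_on_eq[OF continuous_on_const[of _ 0]])
      show "0 = \<eta> s * N s" if "s \<in> {..<r}" for s
        using \<eta>(4)[of s] that r by (auto simp: dist_real_def)
    qed
    moreover have "continuous_on {0<..<T} (\<lambda>s. \<eta> s * N s)"
      by (intro continuous_intros cont\<eta> contN)
    ultimately have "continuous_on ({..<r} \<union> {0<..<T}) (\<lambda>s. \<eta> s * N s)"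
      by (intro continuous_on_open_Un) auto
    then show ?thesis by (rule continuous_on_subset) (use r in auto)
  qed
  \<comment> \<open>The derivative of \<open>\<eta> F\<close> that the product rule and the equation
    predict.\<close>
  define q where "q s = \<eta>' s * F s + \<eta> s * U s - \<mu> / (1 + s) * (\<eta> s * F s) + \<eta> s * N s" for s
  have contq: "continuous_on {0..<T} q"
    unfolding q_def by (intro continuous_intros cont\<eta>' cont\<eta> contF contU cont\<eta>N) auto
  have main: "\<eta> t * F t = integral {0..t} q" if t: "t \<in> {0..<T}" for t
  proof -
    have sub: "{0..t} \<subseteq> {0..<T}" using t by auto
    have I1: "(\<integral>x. - v x s * deriv (\<lambda>r. \<eta> r * \<Phi> x) s + Du x s \<bullet> sgrad (\<lambda>x t. \<eta> t * \<Phi> x) x s \<partial>lebesgue)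
        = - \<eta>' s * F s - \<eta> s * U s" if "s \<in> {0..t}" for s
    proof -
      have s: "s \<in> {0..<T}" using that t by auto
      have us: "memLp 2 (\<lambda>x. u x s)" and vs: "memLp 2 (\<lambda>x. v x s)" and Ds: "memLp 2 (\<lambda>x. Du x s)"
        using u v Du s by (auto simp: Lp_cont_on_def)
      note G = integral_grad_product[OF \<Phi>(1) us Ds bspec[OF wg s]]
      have "deriv (\<lambda>r. \<eta> r * \<Phi> x) s = \<eta>' s * \<Phi> x" for x
        by (rule DERIV_imp_deriv) (auto intro!: derivative_eq_intros \<eta>_deriv)
      then have "(\<integral>x. - v x s * deriv (\<lambda>r. \<eta> r * \<Phi> x) s + Du x s \<bullet> sgrad (\<lambda>x t. \<eta> t * \<Phi> x) x s \<partial>lebesgue)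
          = (\<integral>x. (- \<eta>' s) * (v x s * \<Phi> x) + \<eta> s * (\<Sum>i\<in>Basis. (Du x s \<bullet> i) * frechet_derivative \<Phi> (at x) i) \<partial>lebesgue)"
        unfolding sgrad_product[OF sm] by (simp add: mult_ac)
      also have "\<dots> = - \<eta>' s * F s + \<eta> s * (\<integral>x. (\<Sum>i\<in>Basis. (Du x s \<bullet> i) * frechet_derivative \<Phi> (at x) i) \<partial>lebesgue)"
        using G(1) memLp_2_mult_integrable[OF vs \<Phi>2] by (simp add: F_def)
      also have "(\<integral>x. (\<Sum>i\<in>Basis. (Du x s \<bullet> i) * frechet_derivative \<Phi> (at x) i) \<partial>lebesgue) = - U s"
      proof -
        have [measurable]: "(\<lambda>x. u x s) \<in> borel_measurable lebesgue" "\<Phi> \<in> borel_measurable lebesgue"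
          using us test_fun_measurable[OF \<Phi>(1)] by (auto simp: memLp_def)
        have [measurable]: "(\<lambda>x. \<Sum>i\<in>Basis. frechet_derivative (\<lambda>y. frechet_derivative \<Phi> (at y) i) (at x) i)
            \<in> borel_measurable lebesgue"
          by (intro borel_measurable_sum test_fun_measurable test_fun_partial \<Phi>(1))
        show ?thesis
          unfolding G(2) U_def
          by (intro arg_cong[of _ _ uminus] Bochner_Integration.integral_cong_AE lap s) measurable
      qed
      finally show ?thesis by simp
    qed
    have I2: "(\<integral>x. \<mu> * v x s / (1 + s) powr 1 * (\<eta> s * \<Phi> x) \<partial>lebesgue) = \<mu> / (1 + s) * (\<eta> s * F s)"
      if "s \<in> {0..t}" for s
    proof -
      have "(\<integral>x. \<mu> * v x s / (1 + s) powr 1 * (\<eta> s * \<Phi> x) \<partial>lebesgue)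
          = (\<integral>x. (\<mu> / (1 + s) * \<eta> s) * (v x s * \<Phi> x) \<partial>lebesgue)"
        using that by (simp add: mult_ac)
      also have "\<dots> = (\<mu> / (1 + s) * \<eta> s) * F s" unfolding F_def by (rule integral_mult_right_zero)
      finally show ?thesis by (simp add: mult.assoc)
    qed
    have I3: "(\<integral>x. \<bar>v x s\<bar> powr p * (\<eta> s * \<Phi> x) \<partial>lebesgue) = \<eta> s * N s" for s
    proof -
      have "(\<integral>x. \<bar>v x s\<bar> powr p * (\<eta> s * \<Phi> x) \<partial>lebesgue) = (\<integral>x. \<eta> s * (\<bar>v x s\<bar> powr p * \<Phi> x) \<partial>lebesgue)"
        by (simp add: mult_ac)
      then show ?thesis by (simp add: N_def)
    qed
    have I0: "(\<integral>x. v x t * (\<eta> t * \<Phi> x) \<partial>lebesgue) = \<eta> t * F t"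
    proof -
      have "(\<integral>x. v x t * (\<eta> t * \<Phi> x) \<partial>lebesgue) = (\<integral>x. \<eta> t * (v x t * \<Phi> x) \<partial>lebesgue)"
        by (simp add: mult_ac)
      then show ?thesis by (simp add: F_def)
    qed
    have LINT: "(LINT s:{0..t}|lborel. k s) = integral {0..t} k" if "continuous_on {0..t} k" for k :: "real \<Rightarrow> real"
      by (rule set_borel_integral_eq_integral(2)[OF borel_integrable_atLeastAtMost'[OF that]])
    have c1: "continuous_on {0..t} (\<lambda>s. - \<eta>' s * F s - \<eta> s * U s)"
      and c2: "continuous_on {0..t} (\<lambda>s. \<mu> / (1 + s) * (\<eta> s * F s))"
      and c3: "continuous_on {0..t} (\<lambda>s. \<eta> s * N s)"
      by (intro continuous_intros cont\<eta>' cont\<eta> continuous_on_subset[OF contF sub] continuous_on_subset[OF contU sub]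
          continuous_on_subset[OF cont\<eta>N sub]; force)+
    note i1 = integrable_continuous_interval[OF c1] and i2 = integrable_continuous_interval[OF c2]
      and i3 = integrable_continuous_interval[OF c3]
    have "st_test T (\<lambda>x t. \<eta> t * \<Phi> x)"
      by (rule st_test_product[OF \<Phi>(1) \<eta>(1) \<eta>_supp]) (use r in auto)
    note weak_t = weak[rule_format, OF this t]
    have L1: "(LINT s:{0..t}|lborel. (\<integral>x. - v x s * deriv (\<lambda>r. \<eta> r * \<Phi> x) s
        + Du x s \<bullet> sgrad (\<lambda>x t. \<eta> t * \<Phi> x) x s \<partial>lebesgue)) = (LINT s:{0..t}|lborel. - \<eta>' s * F s - \<eta> s * U s)"
      by (rule set_lebesgue_integral_cong) (simp, intro allI impI I1)
    have L2: "(LINT s:{0..t}|lborel. (\<integral>x. \<mu> * v x s / (1 + s) powr 1 * (\<eta> s * \<Phi> x) \<partial>lebesgue))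
        = (LINT s:{0..t}|lborel. \<mu> / (1 + s) * (\<eta> s * F s))"
      by (rule set_lebesgue_integral_cong) (simp, intro allI impI I2)
    have "\<eta> t * F t + (LINT s:{0..t}|lborel. - \<eta>' s * F s - \<eta> s * U s) + (LINT s:{0..t}|lborel. \<mu> / (1 + s) * (\<eta> s * F s))
        = (LINT s:{0..t}|lborel. \<eta> s * N s)"
      using weak_t unfolding L1 L2 I0 I3 by (simp add: \<open>\<eta> 0 = 0\<close>)
    then have "\<eta> t * F t = integral {0..t} (\<lambda>s. \<eta> s * N s) - integral {0..t} (\<lambda>s. - \<eta>' s * F s - \<eta> s * U s)
        - integral {0..t} (\<lambda>s. \<mu> / (1 + s) * (\<eta> s * F s))"
      unfolding LINT[OF c1] LINT[OF c2] LINT[OF c3] by linarith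
    also have "\<dots> = integral {0..t} (\<lambda>s. \<eta> s * N s - (- \<eta>' s * F s - \<eta> s * U s) - \<mu> / (1 + s) * (\<eta> s * F s))"
      by (simp only: Henstock_Kurzweil_Integration.integral_diff[OF Henstock_Kurzweil_Integration.integrable_diff[OF i3 i1] i2]
          Henstock_Kurzweil_Integration.integral_diff[OF i3 i1])
    also have "\<dots> = integral {0..t} q"
      by (simp add: q_def[abs_def] algebra_simps)
    finally show ?thesis .
  qed
  \<comment> \<open>On the plateau \<eta> is 1 with derivative 0, so the cutoff leaves no trace at
    \<open>t0\<close>.\<close>
  have q0: "q t0 = N t0 + U t0 - \<mu> / (1 + t0) * F t0"
  proof -
    have "\<forall>\<^sub>F t in nhds t0. \<eta> t = 1"
      using eventually_nhds_ball[OF r(1), of t0] by eventually_elim (simp add: \<eta>(3))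
    then have "(\<eta> has_real_derivative 0) (at t0)"
      by (subst DERIV_cong_ev[OF refl _ refl, of _ "\<lambda>t. 1"]) auto
    then have "\<eta>' t0 = 0" using \<eta>_deriv DERIV_unique by blast
    moreover have "\<eta> t0 = 1" using \<eta>(3)[of t0] r by simp
    ultimately show ?thesis by (simp add: q_def)
  qed
  have "((\<lambda>t. integral {0..t} q) has_real_derivative q t0) (at t0 within {0..t0 + r})"
    by (rule integral_has_real_derivative[OF continuous_on_subset[OF contq]]) (use r t0 in auto)
  then have "((\<lambda>t. integral {0..t} q) has_real_derivative q t0) (at t0)"
    using t0 r by (simp add: at_within_Icc_at)
  moreover have "\<forall>\<^sub>F t in nhds t0. F t = integral {0..t} q"
    using eventually_nhds_ball[OF r(1), of t0]
  proof eventually_elim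
    case (elim t)
    then have "\<eta> t = 1" "t \<in> {0..<T}" using \<eta>(3)[of t] r by (auto simp: dist_real_def)
    then show ?case using main[of t] by simp
  qed
  ultimately have "(F has_real_derivative q t0) (at t0)"
    by (subst DERIV_cong_ev[OF refl _ refl, of _ "\<lambda>t. integral {0..t} q"]) auto
  then show ?thesis by (simp add: q0 F_def[abs_def] N_def U_def)
qed

text \<open>The Laplacian of the exponential is the squared length of \<open>w\<close>, here 1,
  times the exponential. Multiplying by a cutoff makes it a test function without changing it on the
  ball; the Laplacian is claimed for interior points only, since derivatives see a
  neighbourhood.\<close>

lemma exp_inner_cutoff:
  fixes w :: "'a::euclidean_space"
  assumes w: "w \<in> Basis" and r: "r > 0"
  obtains \<Phi> :: "'a \<Rightarrow> real" where "test_fun \<Phi>" and "\<And>x. 0 \<le> \<Phi> x"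
    and "\<And>x. norm x \<le> r \<Longrightarrow> \<Phi> x = exp (x \<bullet> w)"
    and "\<And>x. norm x < r \<Longrightarrow>
      (\<Sum>i\<in>Basis. frechet_derivative (\<lambda>y. frechet_derivative \<Phi> (at y) i) (at x) i) = exp (x \<bullet> w)"
proof -
  obtain k :: "'a \<Rightarrow> real" where k: "smooth k" "\<And>x. k x \<ge> 0"
    "\<And>x. dist 0 x \<le> r \<Longrightarrow> k x = 1" "\<And>x. dist 0 x \<ge> 2 * r \<Longrightarrow> k x = 0"
    using smooth_cutoff[OF r] by blast
  define \<Phi> where "\<Phi> x = exp (x \<bullet> w) * k x" for x
  have eq: "\<Phi> x = exp (x \<bullet> w)" if "norm x \<le> r" for x using k(3)[of x] that by (simp add: \<Phi>_def)
  have "smooth \<Phi>"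
    unfolding \<Phi>_def[abs_def]
    by (rule smooth_mult[OF smooth_compose_real[OF smooth_exp smooth_linear[OF bounded_linear_inner_left]] k(1)])
  moreover have "compact (closure {x. \<Phi> x \<noteq> 0})"
  proof -
    have "{x. \<Phi> x \<noteq> 0} \<subseteq> cball 0 (2 * r)"
    proof
      fix x assume "x \<in> {x. \<Phi> x \<noteq> 0}"
      then show "x \<in> cball 0 (2 * r)" using k(4)[of x] by (cases "2 * r \<le> dist 0 x") (auto simp: \<Phi>_def)
    qed
    then have "bounded {x. \<Phi> x \<noteq> 0}" using bounded_subset bounded_cball by blast
    then show ?thesis by (simp add: compact_closure)
  qed
  moreover have "(\<Sum>i\<in>Basis. frechet_derivative (\<lambda>y. frechet_derivative \<Phi> (at y) i) (at x) i) = exp (x \<bullet> w)"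
    if x: "norm x < r" for x
  proof -
    have d: "((\<lambda>x. c * exp (x \<bullet> w)) has_derivative (\<lambda>h. c * exp (y \<bullet> w) * (h \<bullet> w))) (at y)" for y and c :: real
      by (auto intro!: derivative_eq_intros)
    have 1: "frechet_derivative \<Phi> (at y) i = (i \<bullet> w) * exp (y \<bullet> w)" if "y \<in> ball 0 r" for y i
    proof -
      have "(\<Phi> has_derivative (\<lambda>h. 1 * exp (y \<bullet> w) * (h \<bullet> w))) (at y)"
        by (rule has_derivative_transform_within_open[OF d[of 1] open_ball that]) (simp add: eq)
      then show ?thesis by (simp add: frechet_derivative_at[symmetric])
    qed
    have 2: "frechet_derivative (\<lambda>y. frechet_derivative \<Phi> (at y) i) (at x) i = (i \<bullet> w) * exp (x \<bullet> w) * (i \<bullet> w)" for i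
    proof -
      have "((\<lambda>y. frechet_derivative \<Phi> (at y) i) has_derivative (\<lambda>h. (i \<bullet> w) * exp (x \<bullet> w) * (h \<bullet> w))) (at x)"
        by (rule has_derivative_transform_within_open[OF d[of "i \<bullet> w"] open_ball[of 0 r]]) (use x 1 in auto)
      then show ?thesis by (simp add: frechet_derivative_at[symmetric])
    qed
    have "(\<Sum>i\<in>Basis. (i \<bullet> w) * exp (x \<bullet> w) * (i \<bullet> w)) = exp (x \<bullet> w) * (\<Sum>i\<in>Basis. (w \<bullet> i) * (w \<bullet> i))"
      by (simp add: sum_distrib_left inner_commute mult_ac)
    also have "(\<Sum>i\<in>Basis. (w \<bullet> i) * (w \<bullet> i)) = 1"
      using w by (simp add: euclidean_inner[symmetric])
    finally show ?thesis by (simp add: 2)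
  qed
  ultimately show ?thesis
    using that[of \<Phi>] eq k(2) by (simp add: test_fun_def \<Phi>_def)
qed

lemma integral_exp_inner_cball_le:
  fixes w :: "'a::euclidean_space"
  assumes w: "w \<in> Basis" and t: "t \<ge> 0" and R: "R \<ge> 1"
  shows "(\<integral>x. exp (x \<bullet> w) * indicator (cball 0 (t + R)) x \<partial>lebesgue)
    \<le> 2 * exp R * sqrt (4 * pi * R) ^ (DIM('a) - 1) * (exp t * (1 + t) powr ((real DIM('a) - 1) / 2))"
proof (rule integral_real_bounded)
  let ?n = "DIM('a) - 1"
  have "(\<integral>\<^sup>+x. ennreal (exp (x \<bullet> w) * indicator (cball 0 (t + R)) x) \<partial>lebesgue)
      \<le> ennreal (2 * exp (t + R) * sqrt (4 * pi * (t + R)) ^ ?n)"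
    unfolding nn_integral_completion by (rule nn_integral_exp_inner_cball[OF w]) (use t R in simp)
  also have "\<dots> \<le> ennreal (2 * exp R * sqrt (4 * pi * R) ^ ?n * (exp t * (1 + t) powr ((real DIM('a) - 1) / 2)))"
  proof (rule ennreal_leI)
    \<comment> \<open>\<open>R \<ge> 1\<close> lets \<open>R\<close> times \<open>1 + t\<close>
      dominate the radius, so the dependence on \<open>R\<close> goes entirely into the
      constant.\<close>
    have "t + R \<le> R * (1 + t)" using mult_right_mono[OF R t] by (simp add: algebra_simps)
    then have "4 * pi * (t + R) \<le> 4 * pi * (R * (1 + t))" by (intro mult_left_mono) auto
    then have "sqrt (4 * pi * (t + R)) \<le> sqrt (4 * pi * R) * sqrt (1 + t)"
      by (simp add: real_sqrt_mult[symmetric] mult.assoc)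
    then have "sqrt (4 * pi * (t + R)) ^ ?n \<le> (sqrt (4 * pi * R) * sqrt (1 + t)) ^ ?n"
      using t R by (intro power_mono) auto
    also have "\<dots> = sqrt (4 * pi * R) ^ ?n * sqrt (1 + t) ^ ?n"
      by (simp add: power_mult_distrib)
    also have "sqrt (1 + t) ^ ?n = (1 + t) powr ((real DIM('a) - 1) / 2)"
      using t by (simp add: powr_half_sqrt[symmetric] powr_realpow[symmetric] powr_powr of_nat_diff)
    finally show "2 * exp (t + R) * sqrt (4 * pi * (t + R)) ^ ?n
      \<le> 2 * exp R * sqrt (4 * pi * R) ^ ?n * (exp t * (1 + t) powr ((real DIM('a) - 1) / 2))"
      by (simp add: exp_add mult_ac)
  qed
  finally show "(\<integral>\<^sup>+x. ennreal (exp (x \<bullet> w) * indicator (cball 0 (t + R)) x) \<partial>lebesgue)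
      \<le> ennreal (2 * exp R * sqrt (4 * pi * R) ^ ?n * (exp t * (1 + t) powr ((real DIM('a) - 1) / 2)))" .
qed (use R in simp)

text \<open>The origin of the exponent \<open>a\<close>: in \<open>m\<close> times the mass bound
  \<open>K exp t (1 + t)^b\<close> the exponentials cancel and \<open>K (1 + t)^(b + \<mu>)\<close>
  remains. Writing \<open>m\<close> as \<open>m^p m^(1 - p)\<close> turns Jensen's bound for
  \<open>N\<close> into the form that \<open>ode_lifespan\<close> expects.\<close>

lemma powr_weight_identity:
  fixes t \<mu> b p F K :: real
  assumes "t > 0" "K > 0" "F > 0"
  defines "m \<equiv> (1 + t) powr \<mu> * exp (- t)"
  shows "K powr (1 - p) * (1 + t) powr (- ((b + \<mu>) * (p - 1))) * (m * F) powr p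
    = m * ((K * (exp t * (1 + t) powr b)) powr (1 - p) * F powr p)"
proof -
  have m: "m > 0" using assms by (simp add: m_def)
  define Y where "Y = (1 + t) powr (b + \<mu>)"
  have Y: "Y > 0" using assms by (simp add: Y_def)
  have 1: "exp t * (1 + t) powr b = Y / m"
    using assms by (simp add: Y_def m_def powr_add exp_minus field_simps)
  have 2: "(1 + t) powr (- ((b + \<mu>) * (p - 1))) = Y powr (1 - p)"
    by (simp add: Y_def powr_powr) (simp add: algebra_simps)
  have 3: "m * (1 / m) powr (1 - p) = m powr p"
    using m by (simp add: powr_divide powr_diff)
  have "m * ((K * (exp t * (1 + t) powr b)) powr (1 - p) * F powr p)
      = m * ((K * (Y * (1 / m))) powr (1 - p) * F powr p)"
    by (simp add: 1)
  also have "\<dots> = K powr (1 - p) * Y powr (1 - p) * (m * (1 / m) powr (1 - p)) * F powr p"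
    using assms Y m by (simp only: powr_mult) (simp add: powr_mult)
  also have "\<dots> = K powr (1 - p) * Y powr (1 - p) * (m * F) powr p"
    unfolding 3 using m \<open>F > 0\<close> by (simp add: powr_mult)
  finally show ?thesis by (simp add: 2)
qed

text \<open>\<open>Ig\<close> and \<open>K\<close> mention neither \<open>T\<close> nor \<epsilon>
  nor the solution; this makes the final constant uniform. Both use the radius \<open>R + 1\<close>,
  the one available for the support of the time derivative.\<close>

lemma energy_solution_lifespan:
  fixes f g :: "'a::euclidean_space \<Rightarrow> real" and p \<mu> R :: real and w :: 'a
  defines "Ig \<equiv> (\<integral>x. g x * (exp (x \<bullet> w) * indicator (cball 0 (R + 1)) x) \<partial>lebesgue)"
    and "K \<equiv> 2 * exp (R + 1) * sqrt (4 * pi * (R + 1)) ^ (DIM('a) - 1)"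
    and "a \<equiv> (real DIM('a) + 2 * \<mu> - 1) * (p - 1) / 2"
  assumes p: "p > 1" and \<mu>: "\<mu> \<ge> 0" and R: "R \<ge> 0" and w: "w \<in> Basis"
    and g2: "memLp 2 g" and f0: "AE x in lebesgue. f x \<ge> 0" and g0: "AE x in lebesgue. g x \<ge> 0"
    and g_nz: "\<not> (AE x in lebesgue. g x = 0)"
    and \<epsilon>: "\<epsilon> > 0" and sol: "energy_solution \<mu> 1 p \<epsilon> f g T u"
    and supp: "\<And>t. t \<in> {0..<T} \<Longrightarrow> AE x in lebesgue. t + R < norm x \<longrightarrow> u x t = 0"
    and A: "\<And>t. t \<ge> 0 \<Longrightarrow> (A has_real_derivative (1 + t) powr (- a)) (at t)"
    and t: "0 < t" "t < T"
  shows "Ig > 0" and "(p - 1) * K powr (1 - p) / 2 * (A t - A 0) \<le> (\<epsilon> * Ig / 2) powr (1 - p)"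
proof -
  obtain v Du where
    wg: "\<forall>t\<in>{0..<T}. weak_grad (\<lambda>x. u x t) (\<lambda>x. Du x t)" and
    u: "Lp_cont_on 2 {0..<T} (\<lambda>t x. u x t)" and Du: "Lp_cont_on 2 {0..<T} (\<lambda>t x. Du x t)" and
    v: "Lp_cont_on 2 {0..<T} (\<lambda>t x. v x t)" and
    uv: "Lp_deriv_on 2 {0..<T} (\<lambda>t x. u x t) (\<lambda>t x. v x t)" and
    vp: "Lp_cont_on p {0<..<T} (\<lambda>t x. v x t)" and
    init: "AE x in lebesgue. u x 0 = \<epsilon> * f x" "AE x in lebesgue. v x 0 = \<epsilon> * g x" and
    weak: "\<forall>\<phi>. st_test T \<phi> \<longrightarrow> (\<forall>t\<in>{0..<T}.
        (\<integral>x. v x t * \<phi> x t \<partial>lebesgue) - (\<integral>x. v x 0 * \<phi> x 0 \<partial>lebesgue)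
        + (LINT s:{0..t}|lborel. (\<integral>x. - v x s * deriv (\<lambda>r. \<phi> x r) s + Du x s \<bullet> sgrad \<phi> x s \<partial>lebesgue))
        + (LINT s:{0..t}|lborel. (\<integral>x. \<mu> * v x s / (1 + s) powr 1 * \<phi> x s \<partial>lebesgue))
        = (LINT s:{0..t}|lborel. (\<integral>x. \<bar>v x s\<bar> powr p * \<phi> x s \<partial>lebesgue)))"
    using sol unfolding energy_solution_def by blast
  have v_supp: "AE x in lebesgue. s + (R + 1) < norm x \<longrightarrow> v x s = 0" if "s \<in> {0..<T}" for s
    by (rule Lp_deriv_on_support[OF u v uv supp that]) simp_all
  \<comment> \<open>For every time \<open>t\<close> before \<open>T\<close> the radii
    \<open>t + R\<close> and \<open>t + R + 1\<close> stay below \<open>r\<close>, so neither u nor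
    its time derivative ever meets the cutoff.\<close>
  define r where "r = T + R + 1"
  have r: "r > 0" using t R by (simp add: r_def)
  obtain \<Phi> :: "'a \<Rightarrow> real" where \<Phi>: "test_fun \<Phi>" "\<And>x. 0 \<le> \<Phi> x"
    "\<And>x. norm x \<le> r \<Longrightarrow> \<Phi> x = exp (x \<bullet> w)"
    "\<And>x. norm x < r \<Longrightarrow>
      (\<Sum>i\<in>Basis. frechet_derivative (\<lambda>y. frechet_derivative \<Phi> (at y) i) (at x) i) = exp (x \<bullet> w)"
    using exp_inner_cutoff[OF w r] by blast
  obtain B where B: "\<And>x. \<bar>\<Phi> x\<bar> \<le> B" using test_fun_bounded[OF \<Phi>(1)] by blast
  note \<Phi>m[measurable] = test_fun_measurable[OF \<Phi>(1)]
  have \<Phi>2: "memLp 2 \<Phi>" using test_fun_memLp[OF \<Phi>(1)] by simp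
  have int\<Phi>: "integrable lebesgue (\<lambda>x. \<Phi> x * indicator (cball 0 s) x)" for s
  proof -
    have "integrable lebesgue \<Phi>"
      using test_fun_memLp[OF \<Phi>(1), of 1] \<Phi>(2) by (simp add: memLp_def)
    then show ?thesis by (intro integrable_real_mult_indicator) auto
  qed
  have ind: "\<Phi> x * indicator (cball 0 s) x = exp (x \<bullet> w) * indicator (cball 0 s) x" if "s \<le> r" for x s
    using \<Phi>(3)[of x] that by (auto simp: indicator_def)
  define F where "F s = (\<integral>x. v x s * \<Phi> x \<partial>lebesgue)" for s
  define U where "U s = (\<integral>x. u x s * \<Phi> x \<partial>lebesgue)" for s
  define N where "N s = (\<integral>x. \<bar>v x s\<bar> powr p * \<Phi> x \<partial>lebesgue)" for s
  have T0: "0 \<in> {0..<T}" using t by simp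
  \<comment> \<open>The support of \<open>g\<close> is inherited from the solution: at time 0 the
    time derivative is \<open>\<epsilon> * g\<close>, and \<epsilon> is nonzero.\<close>
  have g_supp: "AE x in lebesgue. x \<notin> cball 0 (R + 1) \<longrightarrow> g x = 0"
    using v_supp[OF T0] init(2) by eventually_elim (use \<epsilon> in auto)
  have [measurable]: "g \<in> borel_measurable lebesgue" using g2 by (simp add: memLp_def)
  \<comment> \<open>\<Phi> depends on \<open>T\<close> through \<open>r\<close> whereas
    \<open>Ig\<close> does not; the two integrals agree because \<open>g\<close> vanishes outside
    the smaller ball.\<close>
  have Ig_eq: "Ig = (\<integral>x. g x * \<Phi> x \<partial>lebesgue)"
    unfolding Ig_def
  proof (rule integral_cong_AE)
    show "AE x in lebesgue. g x * (exp (x \<bullet> w) * indicator (cball 0 (R + 1)) x) = g x * \<Phi> x"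
      using g_supp
    proof eventually_elim
      case (elim x)
      have "norm x \<le> R + 1 \<Longrightarrow> norm x \<le> r" using t by (simp add: r_def)
      then show ?case using elim \<Phi>(3)[of x] by (auto simp: indicator_def)
    qed
    have "(\<lambda>x. exp (x \<bullet> w)) \<in> borel_measurable lebesgue"
      by (intro borel_measurable_continuous_onI measurable_completion continuous_intros) simp
    then show "(\<lambda>x. g x * (exp (x \<bullet> w) * indicator (cball 0 (R + 1)) x)) \<in> borel_measurable lebesgue"
      by (intro borel_measurable_times borel_measurable_indicator) auto
  qed measurable
  have intg: "integrable lebesgue (\<lambda>x. g x * \<Phi> x)" by (rule memLp_2_mult_integrable[OF g2 \<Phi>2])
  have g\<Phi>0: "AE x in lebesgue. 0 \<le> g x * \<Phi> x" using g0 by eventually_elim (simp add: \<Phi>(2))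
  show Ig: "Ig > 0"
  proof (rule ccontr)
    assume "\<not> Ig > 0"
    moreover have "Ig \<ge> 0" unfolding Ig_eq by (rule integral_nonneg_AE[OF g\<Phi>0])
    ultimately have "AE x in lebesgue. g x * \<Phi> x = 0"
      using integral_nonneg_eq_0_iff_AE[OF intg g\<Phi>0] by (simp add: Ig_eq)
    then have "AE x in lebesgue. g x = 0"
      using g_supp
    proof eventually_elim
      case (elim x)
      have "norm x \<le> R + 1 \<Longrightarrow> norm x \<le> r" using t by (simp add: r_def)
      then show ?case using elim \<Phi>(3)[of x] by (cases "norm x \<le> R + 1") auto
    qed
    with g_nz show False ..
  qed
  have F0: "F 0 = \<epsilon> * Ig"
  proof -
    have "F 0 = (\<integral>x. \<epsilon> * (g x * \<Phi> x) \<partial>lebesgue)"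
      unfolding F_def
    proof (rule integral_cong_AE)
      show "AE x in lebesgue. v x 0 * \<Phi> x = \<epsilon> * (g x * \<Phi> x)"
        using init(2) by eventually_elim simp
      have "(\<lambda>x. v x 0) \<in> borel_measurable lebesgue" using v T0 by (auto simp: Lp_cont_on_def memLp_def)
      then show "(\<lambda>x. v x 0 * \<Phi> x) \<in> borel_measurable lebesgue" by measurable
    qed measurable
    then show ?thesis by (simp add: Ig_eq)
  qed
  have U0: "U 0 \<ge> 0"
    unfolding U_def
  proof (rule integral_nonneg_AE)
    show "AE x in lebesgue. 0 \<le> u x 0 * \<Phi> x"
      using init(1) f0 by eventually_elim (use \<epsilon> \<Phi>(2) in simp)
  qed
  have K: "K > 0" using R by (simp add: K_def)
  have "(p - 1) * K powr (1 - p) / 2 * (A t - A 0) \<le> (F 0 / 2) powr (1 - p)"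
  proof (rule ode_lifespan[where \<mu> = \<mu> and T = T and F = F and U = U and N = N and a = a])
    show "continuous_on {0..<T} F" unfolding F_def by (rule Lp_cont_on_2_integral[OF v \<Phi>2])
    show "continuous_on {0..<T} U" unfolding U_def by (rule Lp_cont_on_2_integral[OF u \<Phi>2])
    show "continuous_on {0<..<T} N"
      unfolding N_def
      by (rule Lp_cont_on_powr_weighted[OF _ vp \<Phi>m, of B]) (use p \<Phi> B abs_le_D1 in auto)
    show "N s \<ge> 0" for s unfolding N_def using \<Phi>(2) by simp
    show "(U has_real_derivative F s) (at s)" if "s \<in> {0<..<T}" for s
    proof -
      have "(U has_real_derivative F s) (at s within {0..<T})"
        unfolding U_def F_def by (rule Lp_deriv_on_2_integral[OF u v uv \<Phi>2]) (use that in auto)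
      then have "(U has_real_derivative F s) (at s within {0<..<T})"
        by (rule DERIV_subset) auto
      then show ?thesis by (simp only: at_within_open[OF that open_greaterThanLessThan])
    qed
    show "(F has_real_derivative N s + U s - \<mu> / (1 + s) * F s) (at s)" if "s \<in> {0<..<T}" for s
      unfolding F_def N_def U_def
    proof (rule energy_functional_derivative[OF p wg u Du v vp weak \<Phi>(1,2) _ that])
      fix t assume tT: "t \<in> {0..<T}"
      show "AE x in lebesgue.
        u x t * (\<Sum>i\<in>Basis. frechet_derivative (\<lambda>y. frechet_derivative \<Phi> (at y) i) (at x) i) = u x t * \<Phi> x"
        using supp[OF tT]
      proof eventually_elim
        case (elim x)
        then show ?case using \<Phi>(3)[of x] \<Phi>(4)[of x] tT by (cases "t + R < norm x") (auto simp: r_def)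
      qed
    qed
    show "K powr (1 - p) * (1 + s) powr (- a) * ((1 + s) powr \<mu> * exp (- s) * F s) powr p
        \<le> (1 + s) powr \<mu> * exp (- s) * N s" if s: "s \<in> {0<..<T}" and Fs: "F s > 0" for s
    proof -
      define b where "b = (real DIM('a) - 1) / 2"
      have sT: "s \<in> {0..<T}" using s by auto
      have a: "a = (b + \<mu>) * (p - 1)" by (simp add: a_def b_def field_simps)
      have "(K * (exp s * (1 + s) powr b)) powr (1 - p) * F s powr p \<le> N s"
        unfolding F_def N_def
      proof (rule integral_powr_ge_powr_integral[where B = "cball 0 (s + (R + 1))"])
        show "AE x in lebesgue. x \<notin> cball 0 (s + (R + 1)) \<longrightarrow> v x s = 0"
          using v_supp[OF sT] by eventually_elim auto
        show "integrable lebesgue (\<lambda>x. v x s * \<Phi> x)"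
          using v sT by (intro memLp_2_mult_integrable \<Phi>2) (auto simp: Lp_cont_on_def)
        show "integrable lebesgue (\<lambda>x. \<bar>v x s\<bar> powr p * \<Phi> x)"
          by (rule integrable_powr_weighted[OF _ \<Phi>m B]) (use vp s in \<open>auto simp: Lp_cont_on_def\<close>)
        have "(\<integral>x. \<Phi> x * indicator (cball 0 (s + (R + 1))) x \<partial>lebesgue)
            = (\<integral>x. exp (x \<bullet> w) * indicator (cball 0 (s + (R + 1))) x \<partial>lebesgue)"
          by (subst ind) (use s in \<open>auto simp: r_def\<close>)
        also have "\<dots> \<le> K * (exp s * (1 + s) powr b)"
          unfolding K_def b_def by (rule integral_exp_inner_cball_le[OF w]) (use s R in auto)
        finally show "(\<integral>x. \<Phi> x * indicator (cball 0 (s + (R + 1))) x \<partial>lebesgue) \<le> K * (exp s * (1 + s) powr b)" .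
      qed (use p \<Phi>(2) int\<Phi> Fs in \<open>auto simp: F_def\<close>)
      then have "(1 + s) powr \<mu> * exp (- s) * ((K * (exp s * (1 + s) powr b)) powr (1 - p) * F s powr p)
          \<le> (1 + s) powr \<mu> * exp (- s) * N s"
        by (intro mult_left_mono) auto
      then show ?thesis
        unfolding a using powr_weight_identity[of s K "F s" p b \<mu>] s K Fs by simp
    qed
    show "F 0 > 0" using F0 Ig \<epsilon> by simp
  qed (use p \<mu> K U0 A t in auto)
  then show "(p - 1) * K powr (1 - p) / 2 * (A t - A 0) \<le> (\<epsilon> * Ig / 2) powr (1 - p)"
    by (simp add: F0)
qed

section \<open>Lifespan bounds in the subcritical and critical cases\<close>

theorem theorem2p2:
  fixes f g :: "'a::euclidean_space \<Rightarrow> real" and p \<mu> R :: real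
  assumes "p > 1" and "\<mu> > 0" and "R \<ge> 1"
    and "inH1 f" and "memLp 2 g"
    and "AE x in lebesgue. f x \<ge> 0" and "AE x in lebesgue. g x \<ge> 0"
    and "\<not> (AE x in lebesgue. g x = 0)"
  shows "\<exists>\<epsilon>0>0. \<exists>C>0. \<forall>\<epsilon> T u.
    0 < \<epsilon> \<and> \<epsilon> \<le> \<epsilon>0 \<and> energy_solution \<mu> 1 p \<epsilon> f g T u \<and>
    (\<forall>t\<in>{0..<T}. AE x in lebesgue. t + R < norm x \<longrightarrow> u x t = 0) \<longrightarrow>
      (p < p_c (real DIM('a) + 2 * \<mu>) \<longrightarrow>
         T \<le> C * \<epsilon> powr (- (p - 1) / (1 - (real DIM('a) + 2 * \<mu> - 1) * (p - 1) / 2))) \<and>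
      (p = p_c (real DIM('a) + 2 * \<mu>) \<longrightarrow> T \<le> exp (C * \<epsilon> powr (- (p - 1))))"
proof -
  obtain w :: 'a where w: "w \<in> Basis" using nonempty_Basis by blast
  define a where "a = (real DIM('a) + 2 * \<mu> - 1) * (p - 1) / 2"
  define K where "K = 2 * exp (R + 1) * sqrt (4 * pi * (R + 1)) ^ (DIM('a) - 1)"
  define Ig where "Ig = (\<integral>x. g x * (exp (x \<bullet> w) * indicator (cball 0 (R + 1)) x) \<partial>lebesgue)"
  define c where "c = (p - 1) * K powr (1 - p) / 2"
  define D where "D = (Ig / 2) powr (1 - p) / c"
  have "K > 0" using \<open>R \<ge> 1\<close> by (simp add: K_def)
  then have c: "c > 0" using \<open>p > 1\<close> by (simp add: c_def)
  \<comment> \<open>Positivity of \<open>Ig\<close> is established only in the presence of a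
    solution, which supplies the support of \<open>g\<close>. Here the fact that \<open>powr\<close>
    never takes negative values is enough.\<close>
  have D: "D \<ge> 0" using c by (simp add: D_def)
  \<comment> \<open>The first entry is positive and serves the critical case; the second arises from
    solving \<open>(1 + t)^(1 - a) \<le> (1 + (1 - a) D) \<epsilon>^(1 - p)\<close> for
    \<open>1 + t\<close> when \<open>a < 1\<close>.\<close>
  define C where "C = max (D + 1) ((1 + (1 - a) * D) powr (1 / (1 - a)))"
  have C: "C > 0" using D by (simp add: C_def)
  have N: "real DIM('a) + 2 * \<mu> - 1 > 0" using \<open>\<mu> > 0\<close> DIM_ge_Suc0[where 'a = 'a] by linarith
  have sub: "a < 1" if "p < p_c (real DIM('a) + 2 * \<mu>)"
    using that N by (simp add: p_c_def a_def field_simps)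
  have crit: "a = 1" if "p = p_c (real DIM('a) + 2 * \<mu>)"
    using that N by (simp add: p_c_def a_def field_simps)
  have "(a < 1 \<longrightarrow> T \<le> C * \<epsilon> powr (- (p - 1) / (1 - a))) \<and> (a = 1 \<longrightarrow> T \<le> exp (C * \<epsilon> powr (- (p - 1))))"
    if \<epsilon>: "0 < \<epsilon>" "\<epsilon> \<le> 1" and sol: "energy_solution \<mu> 1 p \<epsilon> f g T u"
      and supp: "\<forall>t\<in>{0..<T}. AE x in lebesgue. t + R < norm x \<longrightarrow> u x t = 0" for \<epsilon> T u
  proof -
    have bound: "A t - A 0 \<le> D * \<epsilon> powr (1 - p)"
      if A: "\<And>t. t \<ge> 0 \<Longrightarrow> (A has_real_derivative (1 + t) powr (- a)) (at t)" and t: "0 < t" "t < T" for A t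
    proof -
      have supp': "AE x in lebesgue. t + R < norm x \<longrightarrow> u x t = 0" if "t \<in> {0..<T}" for t
        using supp that by blast
      have "\<mu> \<ge> 0" "R \<ge> 0" using \<open>\<mu> > 0\<close> \<open>R \<ge> 1\<close> by simp_all
      note sol_bound = energy_solution_lifespan[OF \<open>p > 1\<close> this w assms(5-8) \<epsilon>(1) sol supp' A[unfolded a_def] t]
      have Ig: "Ig > 0" unfolding Ig_def by (rule sol_bound(1))
      have "c * (A t - A 0) \<le> (\<epsilon> * Ig / 2) powr (1 - p)"
        unfolding c_def K_def Ig_def by (rule sol_bound(2))
      also have "\<dots> = (Ig / 2) powr (1 - p) * \<epsilon> powr (1 - p)"
        using powr_mult[of \<epsilon> "Ig / 2" "1 - p"] \<epsilon> Ig by (simp add: mult.commute)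
      finally show ?thesis using c by (simp add: D_def field_simps)
    qed
    \<comment> \<open>This explains the choice 1 for the threshold: in the subcritical case an
      additive constant 1 is absorbed into a multiple of
      \<open>\<epsilon> powr (1 - p)\<close>.\<close>
    have \<epsilon>1: "\<epsilon> powr (1 - p) \<ge> 1" using powr_mono'[of "1 - p" 0 \<epsilon>] \<epsilon> \<open>p > 1\<close> by simp
    have "T \<le> C * \<epsilon> powr (- (p - 1) / (1 - a))" if "a < 1"
    proof (rule ccontr)
      assume "\<not> T \<le> C * \<epsilon> powr (- (p - 1) / (1 - a))"
      \<comment> \<open>\<open>bound\<close> speaks of times strictly before \<open>T\<close>, so a
        time is picked between the claimed bound and \<open>T\<close>.\<close>
      then obtain t where t: "C * \<epsilon> powr (- (p - 1) / (1 - a)) < t" "t < T"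
        using dense not_le by blast
      have "0 < t" using t(1) C by (smt (verit) mult_nonneg_nonneg powr_ge_zero)
      have "(1 + t) powr (1 - a) / (1 - a) - (1 + 0) powr (1 - a) / (1 - a) \<le> D * \<epsilon> powr (1 - p)"
        by (rule bound[of "\<lambda>t. (1 + t) powr (1 - a) / (1 - a)"])
          (use \<open>a < 1\<close> \<open>0 < t\<close> t(2) in \<open>auto intro!: derivative_eq_intros\<close>)
      then have "((1 + t) powr (1 - a) - 1) / (1 - a) \<le> D * \<epsilon> powr (1 - p)"
        by (simp add: diff_divide_distrib)
      then have "(1 + t) powr (1 - a) \<le> 1 + (1 - a) * D * \<epsilon> powr (1 - p)"
        using \<open>a < 1\<close> by (simp add: pos_divide_le_eq mult_ac)
      also have "\<dots> \<le> (1 + (1 - a) * D) * \<epsilon> powr (1 - p)"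
        using \<epsilon>1 by (simp add: algebra_simps)
      finally have "((1 + t) powr (1 - a)) powr (1 / (1 - a)) \<le> ((1 + (1 - a) * D) * \<epsilon> powr (1 - p)) powr (1 / (1 - a))"
        using \<open>a < 1\<close> by (intro powr_mono2) auto
      also have "\<dots> = (1 + (1 - a) * D) powr (1 / (1 - a)) * \<epsilon> powr (- (p - 1) / (1 - a))"
        using \<open>a < 1\<close> D by (simp add: powr_mult powr_powr)
      also have "\<dots> \<le> C * \<epsilon> powr (- (p - 1) / (1 - a))"
        by (intro mult_right_mono) (auto simp: C_def)
      also have "((1 + t) powr (1 - a)) powr (1 / (1 - a)) = 1 + t"
        using \<open>a < 1\<close> \<open>0 < t\<close> by (simp add: powr_powr)
      finally show False using t(1) by simp
    qed
    moreover have "T \<le> exp (C * \<epsilon> powr (- (p - 1)))" if "a = 1"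
    proof (rule ccontr)
      assume "\<not> T \<le> exp (C * \<epsilon> powr (- (p - 1)))"
      then obtain t where t: "exp (C * \<epsilon> powr (- (p - 1))) < t" "t < T"
        using dense not_le by blast
      have "0 < t" using t(1) exp_gt_zero less_trans by blast
      have "ln (1 + t) - ln (1 + 0) \<le> D * \<epsilon> powr (1 - p)"
        by (rule bound[of "\<lambda>t. ln (1 + t)"])
          (use \<open>a = 1\<close> \<open>0 < t\<close> t(2) in \<open>auto intro!: derivative_eq_intros simp: powr_minus divide_inverse\<close>)
      also have "\<dots> \<le> C * \<epsilon> powr (1 - p)" by (intro mult_right_mono) (auto simp: C_def)
      finally have "1 + t \<le> exp (C * \<epsilon> powr (- (p - 1)))"
        using \<open>0 < t\<close> exp_le_cancel_iff[of "ln (1 + t)"] by simp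
      then show False using t(1) by simp
    qed
    ultimately show ?thesis by blast
  qed
  then show ?thesis
    unfolding a_def[symmetric]
    by (intro exI[of _ 1] conjI exI[of _ C] C allI impI) (use sub crit in auto)
qed

end
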